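(* Let $n\ge 1$, let $\alpha\in[0,\frac{\pi}{2})$, let $0\le v\le 1$, let $0<m\le M$ be real numbers, and put $h=M/m$. Let $A,B\in\mathbb{M}_n$ be sector matrices with $W(A),W(B)\subset S_\alpha$. Then for every positive unital linear map $\Phi$ from $\mathbb{M}_n$ to $\mathbb{M}_k$ ($k\ge 1$ arbitrary) the following hold. (i) If $0<mI_n\le \Re(A^{-1}),\,\Re(B^{-1})\le MI_n$ (that is, both $\Re(A^{-1})$ and $\Re(B^{-1})$ lie between $mI_n$ and $MI_n$), then $$\Phi^2\big(\Re(A\sharp_v B)\big)\le \sec^{8}(\alpha)\,K^2(h)\,\Phi^2\big(\Re(A!_vB)\big).$$ (ii) If $0<mI_n\le \Re(A),\,\Re(B)\le MI_n$, then $$K^{-2}(h)\cos^{8}(\alpha)\,\Phi^2\big(\Re(A\nabla_vB)\big)\le \Phi^2\big(\Re(A\sharp_vB)\big).$$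
   Context: $\mathbb{M}_n$ is the algebra of $n\times n$ complex matrices, $I_n$ the identity. For $A\in\mathbb{M}_n$, $\Re A=\frac{A+A^*}{2}$ and $\Im A=\frac{A-A^*}{2i}$. Inequalities between Hermitian matrices are in the Loewner order. The numerical range is $W(A)=\{x^*Ax: x\in\mathbb{C}^n,\ x^*x=1\}$. For $\alpha\in[0,\frac{\pi}{2})$, $S_\alpha=\{z\in\mathbb{C}:\Re z>0,\ |\Im z|\le(\Re z)\tan\alpha\}$; $A$ is called a sector matrix if $W(A)\subset S_\alpha$. Such a matrix is invertible, with $\Re A$ positive definite and $W(A^{-1})\subset S_\alpha$. For $A,B$ with $\Re A,\Re B$ positive definite and $v\in[0,1]$: $A\nabla_vB=(1-v)A+vB$; $A!_vB=\big((1-v)A^{-1}+vB^{-1}\big)^{-1}$; and the weighted geometric mean is $A\sharp_vB=\frac{\sin v\pi}{\pi}\int_0^\infty s^{v-1}(A^{-1}+sB^{-1})^{-1}\,ds$ for $0<v<1$, with $A\sharp_0B=A$ and $A\sharp_1B=B$. The Kantorovich constant is $K(h)=\frac{(h+1)^2}{4h}$, where $h=M/m\ge 1$; $K^p(h)=(K(h))^p$. A linear map $\Phi$ is positive if it maps positive semidefinite matrices to positive semidefinite matrices, and unital if it maps the identity to the identity; $\Phi^2(X)=(\Phi(X))^2$. *)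

theory Defs
  imports "HOL-Analysis.Analysis"
begin

definition cdot :: "complex ^ 'n \<Rightarrow> complex ^ 'n \<Rightarrow> complex" where
  "cdot x y = (\<Sum>i\<in>UNIV. cnj (x $ i) * y $ i)"

definition adjoint_mat :: "complex ^ 'n ^ 'm \<Rightarrow> complex ^ 'm ^ 'n" where
  "adjoint_mat A = (\<chi> i j. cnj (A $ j $ i))"

definition hermitian_mat :: "complex ^ 'n ^ 'n \<Rightarrow> bool" where
  "hermitian_mat A \<longleftrightarrow> adjoint_mat A = A"

(* For Hermitian A the number x^* A x is real, so taking its real part loses nothing. *)
definition psd_mat :: "complex ^ 'n ^ 'n \<Rightarrow> bool" where
  "psd_mat A \<longleftrightarrow> hermitian_mat A \<and> (\<forall>x. Re (cdot x (A *v x)) \<ge> 0)"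

definition loewner_le :: "complex ^ 'n ^ 'n \<Rightarrow> complex ^ 'n ^ 'n \<Rightarrow> bool"
    (infix "\<le>\<^sub>L" 50) where
  "A \<le>\<^sub>L B \<longleftrightarrow> psd_mat (B - A)"

definition re_mat :: "complex ^ 'n ^ 'n \<Rightarrow> complex ^ 'n ^ 'n" where
  "re_mat A = (1 / 2) *\<^sub>R (A + adjoint_mat A)"

definition numerical_range :: "complex ^ 'n ^ 'n \<Rightarrow> complex set" where
  "numerical_range A = {cdot x (A *v x) | x. cdot x x = 1}"

definition sector :: "real \<Rightarrow> complex set" where
  "sector \<alpha> = {z. Re z > 0 \<and> \<bar>Im z\<bar> \<le> Re z * tan \<alpha>}"

definition arith_mean :: "real \<Rightarrow> complex ^ 'n ^ 'n \<Rightarrow> complex ^ 'n ^ 'n \<Rightarrow> complex ^ 'n ^ 'n" where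
  "arith_mean v A B = (1 - v) *\<^sub>R A + v *\<^sub>R B"

definition harm_mean :: "real \<Rightarrow> complex ^ 'n ^ 'n \<Rightarrow> complex ^ 'n ^ 'n \<Rightarrow> complex ^ 'n ^ 'n" where
  "harm_mean v A B = matrix_inv ((1 - v) *\<^sub>R matrix_inv A + v *\<^sub>R matrix_inv B)"

(* The integral is the Henstock-Kurzweil integral over the open half-line, so it also
   covers the singularity of the integrand at 0 and the unbounded domain. *)
definition geom_mean :: "real \<Rightarrow> complex ^ 'n ^ 'n \<Rightarrow> complex ^ 'n ^ 'n \<Rightarrow> complex ^ 'n ^ 'n" where
  "geom_mean v A B =
     (if v = 0 then A else if v = 1 then B
      else (sin (v * pi) / pi) *\<^sub>R
        integral {0<..} (\<lambda>s. (s powr (v - 1)) *\<^sub>R matrix_inv (matrix_inv A + s *\<^sub>R matrix_inv B)))"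

definition kantorovich :: "real \<Rightarrow> real" where
  "kantorovich h = (h + 1)\<^sup>2 / (4 * h)"

(* The instance of *s at the type of matrices scales rows by a vector, so complex
   scaling of matrices needs its own operation. *)
definition cscale_mat :: "complex \<Rightarrow> complex ^ 'n ^ 'm \<Rightarrow> complex ^ 'n ^ 'm" where
  "cscale_mat c A = (\<chi> i j. c * A $ i $ j)"

lemma vector_space_cscale_mat:
  "vector_space (cscale_mat :: complex \<Rightarrow> complex ^ 'n ^ 'm \<Rightarrow> complex ^ 'n ^ 'm)"
  by unfold_locales (simp_all add: cscale_mat_def vec_eq_iff algebra_simps)

definition positive_unital_linear_map :: "(complex ^ 'n ^ 'n \<Rightarrow> complex ^ 'k ^ 'k) \<Rightarrow> bool" where
  "positive_unital_linear_map \<Phi> \<longleftrightarrow>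
     Vector_Spaces.linear cscale_mat cscale_mat \<Phi> \<and>
     (\<forall>X. psd_mat X \<longrightarrow> psd_mat (\<Phi> X)) \<and>
     \<Phi> (mat 1) = mat 1"

definition sq_mat :: "complex ^ 'n ^ 'n \<Rightarrow> complex ^ 'n ^ 'n" where
  "sq_mat A = A ** A"

end

theory Submission
  imports Defs
begin

text \<open>Both parts are instances of one principle for a positive unital linear map \<open>\<Phi>\<close>. Let \<open>X\<close> be positive
semidefinite, \<open>Y\<close> positive definite, and suppose \<open>X + \<tau> Y\<^sup>-\<^sup>1 \<le> c I\<close> with \<open>\<tau>, c > 0\<close>. Applying \<open>\<Phi>\<close> and the
inequality \<open>\<Phi>(Y)\<^sup>-\<^sup>1 \<le> \<Phi>(Y\<^sup>-\<^sup>1)\<close> of Choi gives \<open>\<Phi>(X) + \<tau> \<Phi>(Y)\<^sup>-\<^sup>1 \<le> c I\<close>. The operator arithmetic-geometric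
mean inequality of Bhatia and Kittaneh, \<open>\<parallel>P Q\<parallel> \<le> \<parallel>P + Q\<parallel>\<^sup>2 / 4\<close> for positive \<open>P\<close> and \<open>Q\<close>, then
bounds \<open>\<Phi>(X) \<Phi>(Y)\<^sup>-\<^sup>1\<close> in norm by \<open>c\<^sup>2 / (4 \<tau>)\<close>, which is the same as
\<open>\<Phi>(X)\<^sup>2 \<le> (c\<^sup>2 / (4 \<tau>))\<^sup>2 \<Phi>(Y)\<^sup>2\<close> (lemmas \<open>map_inverse_le\<close>, \<open>norm_product_le_quarter_square\<close>,
\<open>map_norm_le\<close>, \<open>sq_mat_loewner_le\<close>).

The hypothesis \<open>X + \<tau> Y\<^sup>-\<^sup>1 \<le> c I\<close> comes from two sources. The first is the elementary inequality
\<open>m M C\<^sup>-\<^sup>1 + C \<le> (m + M) I\<close> for \<open>m I \<le> C \<le> M I\<close>; it produces the Kantorovich constant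
\<open>(m + M)\<^sup>2 / (4 m M)\<close>. The second is the pair of bounds
\<open>Re (X\<^sup>-\<^sup>1) \<le> (Re X)\<^sup>-\<^sup>1 \<le> sec\<^sup>2 \<alpha> Re (X\<^sup>-\<^sup>1)\<close> for a matrix \<open>X\<close> with numerical range in the sector of angle
\<open>\<alpha>\<close>; the factor is written \<open>1 + t\<^sup>2\<close> with \<open>t = tan \<alpha>\<close>. Applied under the integral that
defines the geometric mean, they compare its quadratic form with weighted sums of the quadratic forms of
positive definite matrices: in part (i) from above with those of \<open>(Re A\<^sup>-\<^sup>1)\<^sup>-\<^sup>1\<close> and
\<open>(Re B\<^sup>-\<^sup>1)\<^sup>-\<^sup>1\<close>, in part (ii) from below with those of \<open>(Re A)\<^sup>-\<^sup>1\<close> and \<open>(Re B)\<^sup>-\<^sup>1\<close> in variational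
form (lemmas \<open>geom_mean_form_le\<close>, \<open>geom_mean_form_ge\<close>). In part (i) the bound with \<open>sec\<^sup>2 \<alpha>\<close> also
estimates the inverse of the real part of the harmonic mean. The weights are \<open>1 - v\<close> and \<open>v\<close> because the
integrals of \<open>s\<^bsup>v-1\<^esup> / (1 + s)\<^sup>2\<close> and \<open>s\<^bsup>v\<^esup> / (1 + s)\<^sup>2\<close> over the half-line are in this proportion.

The result is the factor \<open>sec\<^sup>4 \<alpha> K\<^sup>2\<close> in both parts, which is at most \<open>sec\<^sup>8 \<alpha> K\<^sup>2\<close>.

The real part of the complex scalar product is the Euclidean inner product of the real space underlying
\<open>\<complex>\<^sup>n\<close>. A Hermitian matrix is therefore a self-adjoint operator on a real Euclidean space, and everything that
concerns a single quadratic form is proved there.\<close>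

section \<open>Self-adjoint operators on real inner product spaces\<close>

definition selfadj :: "('a::real_inner \<Rightarrow> 'a) \<Rightarrow> bool" where
  "selfadj f \<longleftrightarrow> linear f \<and> (\<forall>x y. x \<bullet> f y = f x \<bullet> y)"

definition psd_op :: "('a::real_inner \<Rightarrow> 'a) \<Rightarrow> bool" where
  "psd_op f \<longleftrightarrow> selfadj f \<and> (\<forall>x. 0 \<le> x \<bullet> f x)"

text \<open>The Cauchy-Schwarz inequality for a form that is only semidefinite is the discriminant bound for a
quadratic polynomial whose leading coefficient may vanish.\<close>

lemma quadratic_nonneg_discriminant:
  fixes a b c :: real
  assumes "\<And>t. 0 \<le> a + 2 * b * t + c * t\<^sup>2" and "0 \<le> c"
  shows "b\<^sup>2 \<le> a * c"
proof (cases "c = 0")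
  case True
  have "b = 0"
  proof (rule ccontr)
    assume "b \<noteq> 0"
    with assms(1)[of "- (a + 1) / (2 * b)"] True show False by (simp add: field_simps)
  qed
  then show ?thesis using True by simp
next
  case False
  then have "0 < c" using assms(2) by simp
  have "0 \<le> a + 2 * b * (- b / c) + c * (- b / c)\<^sup>2" by (rule assms(1))
  also have "\<dots> = a - b\<^sup>2 / c" using \<open>0 < c\<close> by (simp add: field_simps power2_eq_square)
  finally show ?thesis using \<open>0 < c\<close> by (simp add: field_simps)
qed

lemma selfadj_form_add:
  assumes "selfadj f"
  shows "(x + t *\<^sub>R y) \<bullet> f (x + t *\<^sub>R y) = x \<bullet> f x + 2 * (x \<bullet> f y) * t + (y \<bullet> f y) * t\<^sup>2"
proof -
  have l: "linear f" and s: "y \<bullet> f x = x \<bullet> f y" 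
    using assms unfolding selfadj_def by (auto simp: inner_commute)
  show ?thesis
    by (simp add: linear_add[OF l] linear_scale[OF l] inner_add inner_left_distrib inner_right_distrib s
        algebra_simps power2_eq_square)
qed

text \<open>The restriction to a subspace serves the construction of eigenvectors, where nonnegativity of the form
is known only on an invariant subspace.\<close>

lemma form_Cauchy_Schwarz_on:
  assumes "selfadj f" and "subspace S" and "\<And>x. x \<in> S \<Longrightarrow> 0 \<le> x \<bullet> f x"
    and "x \<in> S" and "y \<in> S"
  shows "(x \<bullet> f y)\<^sup>2 \<le> (x \<bullet> f x) * (y \<bullet> f y)"
proof (rule quadratic_nonneg_discriminant)
  show "0 \<le> x \<bullet> f x + 2 * (x \<bullet> f y) * t + (y \<bullet> f y) * t\<^sup>2" for t
  proof -
    have "x + t *\<^sub>R y \<in> S" using assms by (simp add: subspace_add subspace_scale)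
    then show ?thesis using assms(3) by (simp flip: selfadj_form_add[OF assms(1)])
  qed
qed (use assms in auto)

lemma form_Cauchy_Schwarz:
  assumes "psd_op f"
  shows "(x \<bullet> f y)\<^sup>2 \<le> (x \<bullet> f x) * (y \<bullet> f y)"
  using assms by (intro form_Cauchy_Schwarz_on[where S = UNIV]) (auto simp: psd_op_def)

lemma psd_op_null:
  assumes "psd_op f" and "y \<bullet> f y = 0"
  shows "f y = 0"
  using form_Cauchy_Schwarz[OF assms(1), of "f y" y] assms(2) by simp

text \<open>This is \<open>f\<^sup>2 \<le> L f\<close> for \<open>0 \<le> f \<le> L\<close>. It follows from the Cauchy-Schwarz inequality for the form of \<open>f\<close> at the
vectors \<open>x\<close> and \<open>f x\<close>, without a square root of \<open>f\<close>.\<close>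

lemma psd_op_bounded_square:
  assumes f: "psd_op f" and le: "\<And>x. x \<bullet> f x \<le> L * (x \<bullet> x)"
  shows "f x \<bullet> f x \<le> L * (x \<bullet> f x)"
proof (cases "f x = 0")
  case False
  let ?n = "f x \<bullet> f x"
  have "?n\<^sup>2 \<le> (f x \<bullet> f (f x)) * (x \<bullet> f x)" by (rule form_Cauchy_Schwarz[OF f])
  also have "\<dots> \<le> (L * ?n) * (x \<bullet> f x)"
    using f le by (intro mult_right_mono) (auto simp: psd_op_def)
  finally have "?n * ?n \<le> ?n * (L * (x \<bullet> f x))" by (simp add: power2_eq_square mult_ac)
  then show ?thesis using False by (subst (asm) mult_le_cancel_left_pos) auto
qed simp

section \<open>The spectral theorem\<close>

text \<open>A maximizer \<open>e\<close> of the Rayleigh quotient on the unit sphere of \<open>S\<close> exists by compactness. With \<open>l\<close> the maximum,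
the form of \<open>l I - f\<close> is nonnegative on \<open>S\<close> and vanishes at \<open>e\<close>, so Cauchy-Schwarz forces \<open>(l I - f) e = 0\<close>.\<close>

lemma Rayleigh_maximum:
  fixes f :: "'a::euclidean_space \<Rightarrow> 'a"
  assumes f: "selfadj f" and S: "subspace S" and inv: "\<And>x. x \<in> S \<Longrightarrow> f x \<in> S" and ne: "S \<noteq> {0}"
  obtains e l where "e \<in> S" "norm e = 1" "f e = l *\<^sub>R e" "\<And>x. x \<in> S \<Longrightarrow> x \<bullet> f x \<le> l * (x \<bullet> x)"
proof -
  have lin: "linear f" using f by (simp add: selfadj_def)
  have 0: "0 \<in> S" using S by (rule subspace_0)
  then obtain x0 where x0: "x0 \<in> S" "x0 \<noteq> 0" using ne by auto
  have "x0 /\<^sub>R norm x0 \<in> S \<inter> sphere 0 1" using x0 S by (simp add: subspace_scale)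
  then have "S \<inter> sphere 0 1 \<noteq> {}" by blast
  moreover have "compact (S \<inter> sphere 0 1)"
    using S by (simp add: closed_subspace closed_Int_compact)
  moreover have "continuous_on (S \<inter> sphere 0 1) (\<lambda>x. x \<bullet> f x)"
    using lin by (intro continuous_intros linear_continuous_on) (simp add: linear_conv_bounded_linear)
  ultimately obtain e where e: "e \<in> S \<inter> sphere 0 1" "\<forall>x\<in>S \<inter> sphere 0 1. x \<bullet> f x \<le> e \<bullet> f e"
    using continuous_attains_sup[of "S \<inter> sphere 0 1" "\<lambda>x. x \<bullet> f x"] by metis
  define l where "l = e \<bullet> f e"
  define g where "g x = l *\<^sub>R x - f x" for x
  have max: "x \<bullet> f x \<le> l * (x \<bullet> x)" if "x \<in> S" for x
  proof (cases "x = 0")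
    case False
    have "(x /\<^sub>R norm x) \<bullet> f (x /\<^sub>R norm x) \<le> l"
      unfolding l_def using e(2) that S False by (intro bspec[OF e(2)]) (auto simp: subspace_scale)
    then have "(x \<bullet> f x) / (norm x)\<^sup>2 \<le> l"
      by (simp add: linear_scale[OF lin] power2_eq_square divide_inverse mult_ac)
    then show ?thesis using False by (simp add: field_simps power2_norm_eq_inner)
  qed simp
  have ee: "e \<bullet> e = 1" using e by (simp add: dot_square_norm)
  have g: "selfadj g"
    using f unfolding g_def selfadj_def
    by (auto intro!: linear_compose_sub linear_compose_scale_right simp: inner_diff)
       (auto simp: linear_iff algebra_simps)
  have gS: "g e \<in> S" unfolding g_def using e S inv by (auto intro!: subspace_diff subspace_scale)
  have "(g e \<bullet> g e)\<^sup>2 \<le> (g e \<bullet> g (g e)) * (e \<bullet> g e)"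
    using e gS max by (intro form_Cauchy_Schwarz_on[OF g S]) (auto simp: g_def inner_diff)
  also have "e \<bullet> g e = 0" by (simp add: g_def inner_diff l_def ee)
  finally have "g e = 0" by simp
  then have "f e = l *\<^sub>R e" by (simp add: g_def)
  with that max e show thesis by auto
qed

text \<open>Induction on the dimension: split off one eigenvector and continue in its orthogonal complement in \<open>S\<close>, which is
again invariant.\<close>

lemma selfadj_eigenbasis_on:
  fixes f :: "'a::euclidean_space \<Rightarrow> 'a"
  assumes "selfadj f" and "subspace S" and "\<And>x. x \<in> S \<Longrightarrow> f x \<in> S"
  shows "\<exists>B. finite B \<and> B \<subseteq> S \<and> pairwise orthogonal B \<and> (\<forall>b\<in>B. norm b = 1) \<and> span B = S \<and>
             (\<forall>b\<in>B. f b = (b \<bullet> f b) *\<^sub>R b)"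
  using assms(2,3)
proof (induction "dim S" arbitrary: S rule: less_induct)
  case less
  show ?case
  proof (cases "S = {0}")
    case True
    then show ?thesis by (intro exI[of _ "{}"]) auto
  next
    case False
    obtain e l where e: "e \<in> S" "norm e = 1" "f e = l *\<^sub>R e"
      using Rayleigh_maximum[OF assms(1) less.prems False] by metis
    have ee: "e \<bullet> e = 1" using e by (simp add: dot_square_norm)
    define T where "T = {x \<in> S. e \<bullet> x = 0}"
    have T: "subspace T"
      using less.prems(1) by (auto simp: T_def subspace_def inner_right_distrib)
    have "e \<notin> T" using ee by (auto simp: T_def)
    then have "T \<subset> S" using e(1) unfolding T_def by blast
    then have "dim T < dim S" using T less.prems(1) by (metis dim_psubset span_eq_iff)
    moreover have "f x \<in> T" if "x \<in> T" for x
      using that assms(1) less.prems(2) e(3) unfolding T_def selfadj_def by auto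
    ultimately obtain B where B: "finite B" "B \<subseteq> T" "pairwise orthogonal B" "\<forall>b\<in>B. norm b = 1"
        "span B = T" "\<forall>b\<in>B. f b = (b \<bullet> f b) *\<^sub>R b"
      using less.hyps[OF _ T] by blast
    have "pairwise orthogonal (insert e B)"
      using B(2,3) by (auto simp: pairwise_insert T_def orthogonal_def inner_commute)
    moreover have "span (insert e B) = S"
    proof
      show "span (insert e B) \<subseteq> S"
        using B(2) e(1) less.prems(1) by (intro span_minimal) (auto simp: T_def)
      show "S \<subseteq> span (insert e B)"
      proof
        fix x assume "x \<in> S"
        then have "x - (e \<bullet> x) *\<^sub>R e \<in> T" using less.prems(1) e(1)
          by (auto simp: T_def inner_diff ee subspace_diff subspace_scale)
        then show "x \<in> span (insert e B)" unfolding span_insert B(5) by blast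
      qed
    qed
    ultimately show ?thesis
      using B e ee by (intro exI[of _ "insert e B"]) (auto simp: T_def)
  qed
qed

lemma selfadj_eigenbasis:
  fixes f :: "'a::euclidean_space \<Rightarrow> 'a"
  assumes "selfadj f"
  obtains B where "finite B" "pairwise orthogonal B" "\<And>b. b \<in> B \<Longrightarrow> norm b = 1" 
    "\<And>b. b \<in> B \<Longrightarrow> f b = (b \<bullet> f b) *\<^sub>R b" "\<And>x. (\<Sum>b\<in>B. (b \<bullet> x) *\<^sub>R b) = x"
proof -
  obtain B where B: "finite B" "pairwise orthogonal B" "\<forall>b\<in>B. norm b = 1" "span B = UNIV"
      "\<forall>b\<in>B. f b = (b \<bullet> f b) *\<^sub>R b"
    using selfadj_eigenbasis_on[OF assms subspace_UNIV] by auto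
  have "(\<Sum>b\<in>B. (b \<bullet> x) *\<^sub>R b) = x" for x
  proof -
    have "(\<Sum>b\<in>B. (x \<bullet> b) *\<^sub>R b) = x" using B
      by (intro orthonormal_basis_expand) auto
    then show ?thesis by (simp add: inner_commute)
  qed
  with B that show thesis by blast
qed

section \<open>Two operator inequalities behind the Kantorovich constant\<close>

text \<open>The Bhatia-Kittaneh inequality. Let \<open>r = \<parallel>P Q\<parallel>\<close> be positive and take unit singular vectors, \<open>P Q u = r x\<close> and
\<open>Q P x = r u\<close>. Put \<open>\<rho> = x \<bullet> (P + Q) u\<close> and \<open>N = \<parallel>x + u\<parallel>\<^sup>2\<close>. Polarizing the form of \<open>P + Q\<close> gives
\<open>4 \<rho> \<le> c N\<close>. On the other hand \<open>r (x + u) = P b + Q a\<close> with \<open>b = Q u\<close> and \<open>a = P x\<close>, and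
\<open>\<parallel>P b + Q a\<parallel>\<^sup>2 \<le> c (b \<bullet> P b + a \<bullet> Q a)\<close>, where the right-hand side equals \<open>c r \<rho>\<close>; this is \<open>r N \<le> c \<rho>\<close>.
Together \<open>4 r N \<le> c\<^sup>2 N\<close>, and \<open>N\<close> is not zero. In the usual proof the second
step uses square roots of \<open>P\<close> and \<open>Q\<close>; the present form needs only their quadratic forms.\<close>

lemma norm_product_le_quarter_square:
  fixes P Q :: "'a::euclidean_space \<Rightarrow> 'a"
  assumes P: "psd_op P" and Q: "psd_op Q" and c: "0 < c"
    and PQ: "\<And>x. x \<bullet> P x + x \<bullet> Q x \<le> c * (x \<bullet> x)"
  shows "norm (P (Q y)) \<le> c\<^sup>2 / 4 * norm y"
proof -
  have lP: "linear P" and lQ: "linear Q" using P Q by (auto simp: psd_op_def selfadj_def)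
  have sP: "x \<bullet> P y = P x \<bullet> y" and sQ: "x \<bullet> Q y = Q x \<bullet> y" for x y
    using P Q by (auto simp: psd_op_def selfadj_def)
  have pP: "0 \<le> x \<bullet> P x" and pQ: "0 \<le> x \<bullet> Q x" for x
    using P Q by (auto simp: psd_op_def)
  \<comment> \<open>The maximum of the Rayleigh quotient of \<open>(P Q)\<^sup>* (P Q)\<close> supplies the right singular vector \<open>u\<close>.\<close>
  define f where "f = Q \<circ> P \<circ> P \<circ> Q"
  have f: "selfadj f" unfolding f_def selfadj_def
    using lP lQ by (auto intro!: linear_compose) (metis sP sQ)
  have f_form: "x \<bullet> f x = (norm (P (Q x)))\<^sup>2" for x
    using sQ[of x "P (P (Q x))"] sP[of "Q x" "P (Q x)"] by (simp add: f_def power2_norm_eq_inner)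
  obtain u l where u: "norm u = 1" "f u = l *\<^sub>R u" "\<And>x. x \<bullet> f x \<le> l * (x \<bullet> x)"
    using Rayleigh_maximum[OF f subspace_UNIV] by (metis UNIV_I UNIV_not_singleton)
  have uu: "u \<bullet> u = 1" using u by (simp add: dot_square_norm)
  have l0: "0 \<le> l" using f_form[of u] u(2) uu by simp
  define r where "r = sqrt l"
  have r0: "0 \<le> r" and r2: "r\<^sup>2 = l" using l0 by (auto simp: r_def)
  have "r \<le> c\<^sup>2 / 4"
  proof (cases "r = 0")
    case False
    then have r: "0 < r" using r0 by simp
    define x where "x = (1 / r) *\<^sub>R P (Q u)"
    define a where "a = P x"
    define b where "b = Q u"
    have Pb: "P b = r *\<^sub>R x" using r by (simp add: b_def x_def)
    have "Q a = (1 / r) *\<^sub>R f u"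
      by (simp add: a_def x_def f_def linear_scale[OF lP] linear_scale[OF lQ])
    moreover have "l / r = r" using r r2 by (simp add: power2_eq_square field_simps)
    ultimately have Qa: "Q a = r *\<^sub>R u" by (simp add: u)
    define rho where "rho = x \<bullet> P u + x \<bullet> Q u"
    have rho: "rho = a \<bullet> u + b \<bullet> x" using sP[of x u] sQ[of x u]
      by (simp add: rho_def a_def b_def inner_commute)
    define N where "N = (x + u) \<bullet> (x + u)"
    have c1: "4 * rho \<le> c * N"
    proof -
      have "0 \<le> (x - u) \<bullet> P (x - u) + (x - u) \<bullet> Q (x - u)" using pP pQ by (simp add: add_nonneg_nonneg)
      moreover have "(x + u) \<bullet> P (x + u) + (x + u) \<bullet> Q (x + u) -
          ((x - u) \<bullet> P (x - u) + (x - u) \<bullet> Q (x - u)) = 4 * rho"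
        using sP[of u x] sQ[of u x]
        by (simp add: rho_def linear_add[OF lP] linear_add[OF lQ] linear_diff[OF lP] linear_diff[OF lQ]
            inner_add inner_diff inner_commute)
      ultimately show ?thesis using PQ[of "x + u"] by (simp add: N_def)
    qed
    have c2: "r * N \<le> c * rho"
    proof -
      define z where "z = P b + Q a"
      have z: "z = r *\<^sub>R (x + u)" by (simp add: z_def Pb Qa scaleR_add_right)
      \<comment> \<open>Sum the forms of \<open>P\<close> at \<open>b - z / c\<close> and of \<open>Q\<close> at \<open>a - z / c\<close>.\<close>
      have "0 \<le> (b + (- 1 / c) *\<^sub>R z) \<bullet> P (b + (- 1 / c) *\<^sub>R z) + (a + (- 1 / c) *\<^sub>R z) \<bullet> Q (a + (- 1 / c) *\<^sub>R z)"
        using pP pQ by (intro add_nonneg_nonneg)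
      also have "\<dots> = (b \<bullet> P b + a \<bullet> Q a) - 2 / c * (b \<bullet> P z + a \<bullet> Q z) + (z \<bullet> P z + z \<bullet> Q z) / c\<^sup>2"
        using P Q by (subst (1 2) selfadj_form_add) (auto simp: psd_op_def algebra_simps add_divide_distrib power2_eq_square)
      also have "b \<bullet> P z + a \<bullet> Q z = z \<bullet> z"
        using sP[of b z] sQ[of a z] by (simp add: z_def inner_left_distrib)
      also have "(z \<bullet> P z + z \<bullet> Q z) / c\<^sup>2 \<le> c * (z \<bullet> z) / c\<^sup>2"
        by (intro divide_right_mono PQ) simp
      finally have "z \<bullet> z / c \<le> b \<bullet> P b + a \<bullet> Q a"
        using c by (simp add: power2_eq_square)
      also have "b \<bullet> P b + a \<bullet> Q a = r * rho" by (simp add: Pb Qa rho algebra_simps)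
      also have "z \<bullet> z / c = r * (r * N) / c" by (simp add: z N_def)
      finally show ?thesis using r c by (simp add: field_simps)
    qed
    \<comment> \<open>If \<open>u = - x\<close>, then \<open>a \<bullet> Q a = - r (x \<bullet> P x)\<close> is nonpositive, so \<open>Q a = 0\<close>, contradicting \<open>Q a = r u\<close>.\<close>
    have "N \<noteq> 0"
    proof
      assume "N = 0"
      then have "u = - x" by (simp add: N_def eq_neg_iff_add_eq_0 add.commute)
      then have "a \<bullet> Q a = - r * (x \<bullet> P x)" by (simp add: Qa) (simp add: a_def inner_commute)
      then have "a \<bullet> Q a = 0" using pP[of x] pQ[of a] r by (smt (verit) mult_minus_left mult_nonneg_nonneg)
      then have "Q a = 0" by (rule psd_op_null[OF Q])
      then show False using Qa r uu by auto
    qed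
    then have "0 < N" by (simp add: N_def)
    have "4 * (r * N) \<le> c * (4 * rho)" using c2 by simp
    also have "\<dots> \<le> c * (c * N)" using c1 c by simp
    finally show ?thesis using \<open>0 < N\<close> by (simp add: power2_eq_square)
  qed simp
  moreover have "(norm (P (Q y)))\<^sup>2 \<le> (r * norm y)\<^sup>2"
    using u(3)[of y] by (simp add: f_form r2 power_mult_distrib power2_norm_eq_inner)
  then have "norm (P (Q y)) \<le> r * norm y" by (rule power2_le_imp_le) (use r0 in simp)
  ultimately show ?thesis by (meson mult_right_mono norm_ge_zero order_trans)
qed

text \<open>For invertible \<open>f\<close>, at the vector \<open>f p\<close>, this is \<open>m M f\<^sup>-\<^sup>1 + f \<le> m + M\<close>. Let \<open>g = f - m\<close>. Since \<open>f\<close> and \<open>M - f\<close> commute,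
the claim amounts to \<open>f g (M - m - g) \<ge> 0\<close>, and \<open>f = m + g\<close> splits it into \<open>m\<close> times
\<open>g\<^sup>2 \<le> (M - m) g\<close>, which is \<open>psd_op_bounded_square\<close>, and the bound
\<open>g \<le> M - m\<close> evaluated at \<open>g p\<close>.\<close>

lemma psd_op_between_inverse:
  fixes f :: "'a::real_inner \<Rightarrow> 'a"
  assumes f: "selfadj f" and lo: "\<And>x. m * (x \<bullet> x) \<le> x \<bullet> f x" and up: "\<And>x. x \<bullet> f x \<le> M * (x \<bullet> x)"
    and m: "0 \<le> m"
  shows "m * M * (p \<bullet> f p) + f p \<bullet> f (f p) \<le> (m + M) * (f p \<bullet> f p)"
proof -
  have lin: "linear f" using f by (simp add: selfadj_def)
  have sf: "x \<bullet> f y = f x \<bullet> y" for x y using f by (simp add: selfadj_def)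
  define g where "g x = f x - m *\<^sub>R x" for x
  have "selfadj g" unfolding g_def selfadj_def
    using lin by (auto simp: inner_diff sf linear_iff algebra_simps)
  then have g: "psd_op g" using lo by (simp add: psd_op_def g_def inner_diff)
  have "g p \<bullet> g p \<le> (M - m) * (p \<bullet> g p)"
    using up by (intro psd_op_bounded_square[OF g]) (simp add: g_def inner_diff algebra_simps)
  moreover have "g p \<bullet> g (g p) \<le> (M - m) * (g p \<bullet> g p)"
    using up[of "g p"] by (simp only: g_def) (simp add: inner_diff algebra_simps)
  ultimately have "m * (g p \<bullet> g p) + g p \<bullet> g (g p) \<le> m * ((M - m) * (p \<bullet> g p)) + (M - m) * (g p \<bullet> g p)"
    using m by (intro add_mono mult_left_mono)
  then show ?thesis 
    using sf[of p "f p"] inner_commute[of p "f p"]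
    by (simp add: g_def linear_diff[OF lin] linear_scale[OF lin] inner_diff algebra_simps)
qed

section \<open>Complex matrices and the real inner product\<close>

lemma Re_cdot: "Re (cdot x y) = x \<bullet> y"
  by (simp add: cdot_def inner_vec_def inner_complex_def)

lemma cdot_commute: "cdot y x = cnj (cdot x y)"
  by (simp add: cdot_def mult.commute)

lemma cdot_add_left: "cdot (x + y) z = cdot x z + cdot y z"
  and cdot_add_right: "cdot z (x + y) = cdot z x + cdot z y"
  by (simp_all add: cdot_def algebra_simps sum.distrib)

lemma cdot_diff_left: "cdot (x - y) z = cdot x z - cdot y z"
  and cdot_diff_right: "cdot z (x - y) = cdot z x - cdot z y"
  by (simp_all add: cdot_def algebra_simps sum_subtractf)

lemma cdot_minus_left: "cdot (- x) z = - cdot x z"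
  by (simp add: cdot_def sum_negf)

lemma cdot_scale_left: "cdot (c *s x) y = cnj c * cdot x y"
  and cdot_scale_right: "cdot x (c *s y) = c * cdot x y"
  by (simp_all add: cdot_def sum_distrib_left mult_ac)

lemma cdot_scaleR_left: "cdot (r *\<^sub>R x) y = of_real r * cdot x y"
  and cdot_scaleR_right: "cdot x (r *\<^sub>R y) = of_real r * cdot x y"
  by (simp_all add: cdot_def sum_distrib_left scaleR_conv_of_real[where 'a = complex] mult_ac)

lemma cdot_self: "cdot x x = of_real (x \<bullet> x)"
proof -
  have "Im (cdot x x) = 0" using cdot_commute[of x x] by (simp add: complex_eq_iff)
  then show ?thesis by (simp add: complex_eq_iff Re_cdot)
qed

lemma cdot_matrix_right: "cdot x (A *v y) = cdot (adjoint_mat A *v x) y"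
proof -
  have "cdot x (A *v y) = (\<Sum>i\<in>UNIV. \<Sum>j\<in>UNIV. cnj (x $ i) * A $ i $ j * y $ j)"
    by (simp add: cdot_def matrix_vector_mult_def sum_distrib_left mult_ac)
  also have "\<dots> = (\<Sum>j\<in>UNIV. \<Sum>i\<in>UNIV. cnj (x $ i) * A $ i $ j * y $ j)"
    by (rule sum.swap)
  also have "\<dots> = cdot (adjoint_mat A *v x) y"
    by (simp add: cdot_def matrix_vector_mult_def adjoint_mat_def sum_distrib_left mult_ac)
  finally show ?thesis .
qed

lemma adjoint_mat_adjoint_mat [simp]: "adjoint_mat (adjoint_mat A) = A"
  and adjoint_mat_add [simp]: "adjoint_mat (A + B) = adjoint_mat A + adjoint_mat B"
  and adjoint_mat_diff [simp]: "adjoint_mat (A - B) = adjoint_mat A - adjoint_mat B"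
  and adjoint_mat_scaleR [simp]: "adjoint_mat (r *\<^sub>R A) = r *\<^sub>R adjoint_mat A"
  by (simp_all add: adjoint_mat_def vec_eq_iff)

lemma adjoint_mat_mult [simp]: "adjoint_mat (A ** B) = adjoint_mat B ** adjoint_mat A"
  by (simp add: adjoint_mat_def matrix_matrix_mult_def vec_eq_iff mult.commute)

lemma adjoint_mat_one [simp]: "adjoint_mat (mat 1) = mat 1"
  by (auto simp: adjoint_mat_def mat_def vec_eq_iff)

lemma scaleR_mat_vec: "(r *\<^sub>R A) *v x = r *\<^sub>R (A *v x)" for A :: "complex^'n^'m"
  by (simp add: matrix_vector_mult_def vec_eq_iff scaleR_sum_right)

lemma mat_vec_scaleR: "A *v (r *\<^sub>R x) = r *\<^sub>R (A *v x)" for A :: "complex^'n^'m"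
  by (simp add: matrix_vector_mult_def vec_eq_iff scaleR_sum_right)

lemmas mat_vec_simps = scaleR_mat_vec mat_vec_scaleR matrix_vector_mult_add_rdistrib 
  matrix_vector_mult_diff_rdistrib matrix_vector_right_distrib matrix_vector_mult_diff_distrib 

lemma hermitian_selfadj:
  assumes "hermitian_mat A"
  shows "selfadj ((*v) A)"
  using assms cdot_matrix_right[of _ A]
  by (auto simp: selfadj_def hermitian_mat_def simp flip: Re_cdot)

lemma psd_mat_psd_op:
  assumes "psd_mat A"
  shows "psd_op ((*v) A)"
  using assms by (simp add: psd_mat_def psd_op_def hermitian_selfadj Re_cdot)

lemma loewner_le_iff:
  assumes "hermitian_mat A" and "hermitian_mat B"
  shows "A \<le>\<^sub>L B \<longleftrightarrow> (\<forall>x. x \<bullet> (A *v x) \<le> x \<bullet> (B *v x))"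
  using assms by (simp add: loewner_le_def psd_mat_def hermitian_mat_def Re_cdot mat_vec_simps inner_diff)

lemma loewner_leD: "A \<le>\<^sub>L B \<Longrightarrow> x \<bullet> (A *v x) \<le> x \<bullet> (B *v x)"
  by (auto simp add: loewner_le_def psd_mat_def Re_cdot mat_vec_simps inner_diff)

lemma loewner_le_scaleR_left:
  assumes "X \<le>\<^sub>L l *\<^sub>R Y" and "0 < l"
  shows "(1 / l) *\<^sub>R X \<le>\<^sub>L Y"
proof -
  have "psd_mat ((1 / l) *\<^sub>R (l *\<^sub>R Y - X))"
    using assms by (simp add: loewner_le_def psd_mat_def hermitian_mat_def mat_vec_simps Re_cdot)
  then show ?thesis using assms(2) by (simp add: loewner_le_def scaleR_diff_right)
qed

lemma hermitian_re_mat: "hermitian_mat (re_mat A)"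
  by (simp add: hermitian_mat_def re_mat_def add.commute)

lemma re_mat_form: "x \<bullet> (re_mat A *v x) = x \<bullet> (A *v x)"
proof -
  have "x \<bullet> (adjoint_mat A *v x) = x \<bullet> (A *v x)"
    unfolding Re_cdot[symmetric] cdot_matrix_right[of x A] by (subst cdot_commute) simp
  then show ?thesis by (simp add: re_mat_def mat_vec_simps inner_add)
qed

lemma invertible_matrix_inv:
  assumes "invertible A"
  shows "A ** matrix_inv A = mat 1" and "matrix_inv A ** A = mat 1"
  using someI_ex[OF assms[unfolded invertible_def]] by (simp_all add: matrix_inv_def)

lemma mat_vec_inverse:
  fixes A :: "complex^'n^'n"
  assumes "invertible A"
  shows "A *v (matrix_inv A *v x) = x" and "matrix_inv A *v (A *v x) = x"
  using invertible_matrix_inv[OF assms] by (simp_all add: matrix_vector_mul_assoc)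

lemma matrix_inv_unique:
  assumes "A ** B = mat 1" and "B ** A = mat 1"
  shows "matrix_inv A = B"
proof -
  have "invertible A" using assms by (auto simp: invertible_def)
  then have "matrix_inv A = matrix_inv A ** (A ** B)" by (simp add: assms)
  also have "\<dots> = B" using \<open>invertible A\<close> by (simp add: matrix_mul_assoc invertible_matrix_inv)
  finally show ?thesis .
qed

lemma matrix_inv_matrix_inv:
  assumes "invertible A"
  shows "matrix_inv (matrix_inv A) = A"
  using assms by (intro matrix_inv_unique invertible_matrix_inv)

section \<open>Strictly accretive matrices\<close>

definition strictly_accretive :: "complex^'n^'n \<Rightarrow> bool" where
  "strictly_accretive X \<longleftrightarrow> (\<forall>x. x \<noteq> 0 \<longrightarrow> 0 < x \<bullet> (X *v x))"

lemma strictly_accretive_nonneg: "strictly_accretive X \<Longrightarrow> 0 \<le> x \<bullet> (X *v x)"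
  by (cases "x = 0") (auto simp: strictly_accretive_def less_imp_le)

lemma strictly_accretive_invertible:
  assumes "strictly_accretive X"
  shows "invertible X"
proof -
  have "x = 0" if "X *v x = 0" for x
    using assms that by (metis inner_zero_right less_irrefl strictly_accretive_def)
  then show ?thesis by (metis invertible_left_inverse matrix_left_invertible_ker)
qed

lemma strictly_accretive_re_mat: "strictly_accretive (re_mat X) \<longleftrightarrow> strictly_accretive X"
  by (simp add: strictly_accretive_def re_mat_form)

lemma strictly_accretive_add:
  "strictly_accretive X \<Longrightarrow> strictly_accretive Y \<Longrightarrow> strictly_accretive (X + Y)"
  by (simp add: strictly_accretive_def mat_vec_simps inner_add add_pos_pos)

lemma strictly_accretive_scaleR:
  "strictly_accretive X \<Longrightarrow> 0 < r \<Longrightarrow> strictly_accretive (r *\<^sub>R X)"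
  by (simp add: strictly_accretive_def mat_vec_simps)

lemma strictly_accretive_convex:
  assumes "strictly_accretive X" and "strictly_accretive Y" and "0 \<le> v" "v \<le> 1"
  shows "strictly_accretive ((1 - v) *\<^sub>R X + v *\<^sub>R Y)"
proof -
  consider "v = 0" | "v = 1" | "0 < v" "v < 1" using assms(3,4) by linarith
  then show ?thesis using assms(1,2)
    by cases (auto intro!: strictly_accretive_add strictly_accretive_scaleR)
qed

text \<open>The smallest eigenvalue of the real part, as the largest one of its negative.\<close>

lemma strictly_accretive_lower_bound:
  assumes "strictly_accretive X"
  obtains \<mu> where "0 < \<mu>" "\<And>x. \<mu> * (x \<bullet> x) \<le> x \<bullet> (X *v x)"
proof -
  have "selfadj ((*v) (re_mat X))" by (intro hermitian_selfadj hermitian_re_mat)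
  then have "selfadj (\<lambda>x. - (re_mat X *v x))"
    by (auto simp: selfadj_def intro!: linear_compose_neg)
  then obtain e l where e: "norm e = 1" "- (re_mat X *v e) = l *\<^sub>R e"
      "\<And>x. x \<bullet> - (re_mat X *v x) \<le> l * (x \<bullet> x)"
    using Rayleigh_maximum[OF _ subspace_UNIV] by (metis (lifting) UNIV_I UNIV_not_singleton)
  have "e \<bullet> - (re_mat X *v e) = l" unfolding e(2) using e(1) by (simp add: dot_square_norm)
  moreover have "e \<noteq> 0" using e(1) by auto
  ultimately have "0 < - l" using assms by (auto simp: re_mat_form strictly_accretive_def)
  moreover have "- l * (x \<bullet> x) \<le> x \<bullet> (X *v x)" for x
    using e(3)[of x] by (simp add: re_mat_form)
  ultimately show thesis by (rule that)
qed

text \<open>Let \<open>X z = y\<close>, let \<open>R\<close> be the real part of \<open>X\<close> and \<open>R w = y\<close>. Then \<open>z \<bullet> R z = z \<bullet> y = z \<bullet> R w\<close>, so the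
Cauchy-Schwarz inequality for the form of \<open>R\<close> gives \<open>z \<bullet> y \<le> w \<bullet> y\<close>.\<close>

lemma re_mat_inverse_le:
  assumes X: "strictly_accretive X"
  shows "y \<bullet> (matrix_inv X *v y) \<le> y \<bullet> (matrix_inv (re_mat X) *v y)"
proof -
  let ?R = "re_mat X"
  define z w where "z = matrix_inv X *v y" and "w = matrix_inv ?R *v y"
  have y: "X *v z = y" "?R *v w = y"
    using X by (simp_all add: z_def w_def mat_vec_inverse strictly_accretive_invertible strictly_accretive_re_mat)
  have R: "psd_op ((*v) ?R)"
    using X by (simp add: psd_op_def hermitian_selfadj hermitian_re_mat re_mat_form strictly_accretive_nonneg)
  have zz: "z \<bullet> (?R *v z) = z \<bullet> y" by (simp add: re_mat_form y)
  have "(z \<bullet> y)\<^sup>2 \<le> (z \<bullet> y) * (w \<bullet> y)"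
    using form_Cauchy_Schwarz[OF R, of z w] by (simp add: zz y)
  moreover have "0 \<le> w \<bullet> y" and "0 \<le> z \<bullet> y"
    using R unfolding psd_op_def zz[symmetric] by (metis y(2), simp)
  ultimately have "z \<bullet> y \<le> w \<bullet> y"
    by (cases "z \<bullet> y = 0") (auto simp: power2_eq_square)
  then show ?thesis by (simp add: z_def w_def inner_commute)
qed

section \<open>Sectorial matrices\<close>

text \<open>The homogeneous form of the condition that the numerical range lies in the sector of angle \<open>arctan t\<close>. Without
a normalization of \<open>x\<close> it is visibly stable under sums and inverses.\<close>

definition sectorial :: "real \<Rightarrow> complex^'n^'n \<Rightarrow> bool" where
  "sectorial t X \<longleftrightarrow> strictly_accretive X \<and> (\<forall>x. \<bar>Im (cdot x (X *v x))\<bar> \<le> t * (x \<bullet> (X *v x)))"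

lemma sectorial_numerical_range:
  assumes "numerical_range A \<subseteq> sector \<alpha>"
  shows "sectorial (tan \<alpha>) A"
proof -
  have *: "0 < x \<bullet> (A *v x) \<and> \<bar>Im (cdot x (A *v x))\<bar> \<le> tan \<alpha> * (x \<bullet> (A *v x))" if "x \<noteq> 0" for x
  proof -
    define u where "u = (1 / norm x) *\<^sub>R x"
    have x: "x = norm x *\<^sub>R u" using that by (simp add: u_def)
    have "norm u = 1" using that by (simp add: u_def)
    then have "cdot u u = 1" by (simp add: cdot_self dot_square_norm)
    then have u: "cdot u (A *v u) \<in> sector \<alpha>" using assms by (auto simp: numerical_range_def)
    have c: "cdot x (A *v x) = of_real ((norm x)\<^sup>2) * cdot u (A *v u)"
      by (subst (1 2) x) (simp add: mat_vec_simps cdot_scaleR_left cdot_scaleR_right power2_eq_square)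
    have n: "0 < (norm x)\<^sup>2" using that by simp
    have "Im (cdot x (A *v x)) = (norm x)\<^sup>2 * Im (cdot u (A *v u))"
      and r: "x \<bullet> (A *v x) = (norm x)\<^sup>2 * Re (cdot u (A *v u))" unfolding c Re_cdot[symmetric] 
      by (simp_all only: Re_complex_of_real Im_complex_of_real times_complex.simps)
    moreover have "(norm x)\<^sup>2 * \<bar>Im (cdot u (A *v u))\<bar> \<le> (norm x)\<^sup>2 * (Re (cdot u (A *v u)) * tan \<alpha>)"
      using u by (intro mult_left_mono) (auto simp: sector_def)
    moreover have "0 < Re (cdot u (A *v u))" using u by (auto simp: sector_def)
    ultimately show ?thesis using n by (simp add: abs_mult mult_ac del: Re_cdot)
  qed
  then show ?thesis
    unfolding sectorial_def strictly_accretive_def by (metis (no_types) abs_zero cdot_self inner_zero_left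
      matrix_vector_mult_0_right mult_zero_right order_refl zero_complex.sel(2) of_real_0)
qed

lemma sectorial_add: "sectorial t X \<Longrightarrow> sectorial t Y \<Longrightarrow> sectorial t (X + Y)"
  unfolding sectorial_def mat_vec_simps cdot_add_right inner_add_right distrib_left plus_complex.simps
  using strictly_accretive_add abs_triangle_ineq add_mono order_trans by (smt (verit))

lemma sectorial_scaleR: "sectorial t X \<Longrightarrow> 0 < r \<Longrightarrow> sectorial t (r *\<^sub>R X)"
  by (simp add: sectorial_def strictly_accretive_scaleR mat_vec_simps cdot_scaleR_right abs_mult)

lemma sectorial_convex:
  assumes "sectorial t X" and "sectorial t Y" and "0 \<le> v" "v \<le> 1"
  shows "sectorial t ((1 - v) *\<^sub>R X + v *\<^sub>R Y)"
proof -
  consider "v = 0" | "v = 1" | "0 < v" "v < 1" using assms(3,4) by linarith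
  then show ?thesis using assms(1,2)
    by cases (auto intro!: sectorial_add sectorial_scaleR)
qed

lemma cdot_matrix_inv:
  fixes X :: "complex^'n^'n"
  assumes "invertible X"
  shows "cdot y (matrix_inv X *v y) = cnj (cdot (matrix_inv X *v y) (X *v (matrix_inv X *v y)))"
  unfolding mat_vec_inverse(1)[OF assms] by (rule cdot_commute)

lemma inner_matrix_inv:
  fixes X :: "complex^'n^'n"
  assumes "invertible X"
  shows "y \<bullet> (matrix_inv X *v y) = (matrix_inv X *v y) \<bullet> (X *v (matrix_inv X *v y))"
  unfolding mat_vec_inverse(1)[OF assms] by (rule inner_commute)

lemma strictly_accretive_matrix_inv:
  assumes "strictly_accretive X"
  shows "strictly_accretive (matrix_inv X)"
proof -
  have i: "invertible X" using assms by (rule strictly_accretive_invertible)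
  have "matrix_inv X *v y \<noteq> 0" if "y \<noteq> 0" for y
    using mat_vec_inverse(1)[OF i, of y] that by auto
  then show ?thesis using assms unfolding strictly_accretive_def inner_matrix_inv[OF i] by blast
qed

lemma sectorial_matrix_inv:
  assumes "sectorial t X"
  shows "sectorial t (matrix_inv X)"
proof -
  have i: "invertible X" using assms by (simp add: sectorial_def strictly_accretive_invertible)
  show ?thesis using assms unfolding sectorial_def cdot_matrix_inv[OF i] inner_matrix_inv[OF i]
    using strictly_accretive_matrix_inv by auto
qed

text \<open>Write the skew part \<open>X - Re X\<close> as \<open>\<i> J\<close> with \<open>J\<close> Hermitian. The sector condition says that the form of \<open>J\<close> is
dominated in absolute value by \<open>t\<close> times that of \<open>X\<close>. Polarization and the discriminant bound turn this into a bound for the mixed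
values of the form; replacing \<open>d\<close> by \<open>- \<i> d\<close> moves the imaginary part of the complex scalar
product to its real part.\<close>

lemma skew_part_form_bound:
  assumes "sectorial t X" and "0 \<le> t"
  shows "(d \<bullet> ((X - re_mat X) *v z))\<^sup>2 \<le> t\<^sup>2 * (d \<bullet> (X *v d)) * (z \<bullet> (X *v z))"
proof -
  define K where "K = X - re_mat X"
  define q where "q x = x \<bullet> (X *v x)" for x
  define b where "b x y = Im (cdot x (K *v y))" for x y
  have "adjoint_mat K = - K" by (simp add: K_def re_mat_def vec_eq_iff adjoint_mat_def
        complex_eq_iff field_simps)
  moreover have "(- K) *v y = - (K *v y)" for y
    by (simp add: vec_eq_iff matrix_vector_mult_def sum_negf)
  ultimately have "cdot y (K *v x) = - cdot (K *v y) x" for x y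
    by (simp add: cdot_matrix_right cdot_minus_left)
  then have K_skew: "cdot y (K *v x) = - cnj (cdot x (K *v y))" for x y
    unfolding cdot_commute[of "K *v y" x, symmetric] .
  have b_sym: "b y x = b x y" for x y unfolding b_def by (subst K_skew) simp
  have "Im (cdot x (re_mat X *v x)) = 0" for x
  proof -
    have "cdot x (re_mat X *v x) = cdot (re_mat X *v x) x"
      by (metis cdot_matrix_right hermitian_mat_def hermitian_re_mat)
    also have "\<dots> = cnj (cdot x (re_mat X *v x))" by (rule cdot_commute)
    finally have "cdot x (re_mat X *v x) = cnj (cdot x (re_mat X *v x))" .
    from arg_cong[OF this, of Im] show ?thesis by simp
  qed
  then have b_form: "b x x = Im (cdot x (X *v x))" for x
    by (simp add: b_def K_def mat_vec_simps cdot_diff_right)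
  then have b_le: "\<bar>b x x\<bar> \<le> t * q x" for x
    using assms by (simp add: sectorial_def q_def)
  have pol: "4 * \<bar>b x y\<bar> \<le> 2 * t * (q x + q y)" for x y
  proof -
    have "4 * b x y = b (x + y) (x + y) - b (x - y) (x - y)"
      using b_sym[of x y] by (simp add: b_def mat_vec_simps cdot_add_left cdot_add_right cdot_diff_left cdot_diff_right)
    then have "4 * \<bar>b x y\<bar> \<le> t * q (x + y) + t * q (x - y)"
      using b_le[of "x + y"] b_le[of "x - y"] by linarith
    also have "\<dots> = t * (q (x + y) + q (x - y))" by (simp add: algebra_simps)
    also have "q (x + y) + q (x - y) = 2 * (q x + q y)"
      by (simp add: q_def mat_vec_simps inner_add inner_diff)
    finally show ?thesis by (simp add: algebra_simps)
  qed
  define e where "e = (- \<i>) *s d"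
  have "(b e z)\<^sup>2 \<le> (t * q e) * (t * q z)"
  proof (rule quadratic_nonneg_discriminant)
    show "0 \<le> t * q z" using assms strictly_accretive_nonneg[of X z] by (simp add: sectorial_def q_def)
    show "0 \<le> t * q e + 2 * b e z * r + t * q z * r\<^sup>2" for r
    proof -
      have "b e (r *\<^sub>R z) = r * b e z" by (simp add: b_def mat_vec_simps cdot_scaleR_right)
      moreover have "q (r *\<^sub>R z) = r\<^sup>2 * q z" by (simp add: q_def mat_vec_simps power2_eq_square)
      ultimately have "4 * \<bar>r * b e z\<bar> \<le> 2 * t * (q e + r\<^sup>2 * q z)" using pol[of e "r *\<^sub>R z"] by simp
      then have "- (4 * (r * b e z)) \<le> 2 * (t * q e + t * q z * r\<^sup>2)" by (simp add: algebra_simps abs_le_iff)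
      then show ?thesis by (simp add: algebra_simps)
    qed
  qed
  moreover have "q e = q d"
    unfolding q_def Re_cdot[symmetric] e_def vector_scalar_commute cdot_scale_left cdot_scale_right by simp
  moreover have "b e z = d \<bullet> (K *v z)"
    unfolding Re_cdot[symmetric] b_def e_def cdot_scale_left by simp
  ultimately show ?thesis by (simp add: K_def q_def power2_eq_square mult_ac)
qed

text \<open>Let \<open>X z = y\<close>, \<open>R = Re X\<close>, \<open>R w = y\<close> and \<open>d = w - z\<close>. Then \<open>R d = (X - R) z\<close>, and \<open>z\<close> is \<open>R\<close>-orthogonal to \<open>d\<close>
because \<open>X - R\<close> is skew. By Pythagoras \<open>w \<bullet> R w = z \<bullet> R z + d \<bullet> R d\<close>, and \<open>skew_part_form_bound\<close> gives
\<open>d \<bullet> R d \<le> t\<^sup>2 z \<bullet> R z\<close>.\<close>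

lemma inverse_re_mat_le:
  assumes X: "sectorial t X" and t: "0 \<le> t"
  shows "y \<bullet> (matrix_inv (re_mat X) *v y) \<le> (1 + t\<^sup>2) * (y \<bullet> (matrix_inv X *v y))"
proof -
  let ?R = "re_mat X"
  have acc: "strictly_accretive X" using X by (simp add: sectorial_def)
  define z w where "z = matrix_inv X *v y" and "w = matrix_inv ?R *v y"
  have y: "X *v z = y" "?R *v w = y"
    using acc by (simp_all add: z_def w_def mat_vec_inverse strictly_accretive_invertible strictly_accretive_re_mat)
  define d where "d = w - z"
  have sR: "a \<bullet> (?R *v b) = (?R *v a) \<bullet> b" for a b
    using hermitian_selfadj[OF hermitian_re_mat] by (auto simp: selfadj_def)
  have Rd: "?R *v d = (X - ?R) *v z" by (simp add: d_def mat_vec_simps y)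
  have zz: "z \<bullet> (?R *v z) = z \<bullet> y" by (simp add: re_mat_form y)
  have zd: "z \<bullet> (?R *v d) = 0" by (simp add: Rd mat_vec_simps inner_diff zz y)
  have "w \<bullet> y = (z + d) \<bullet> (?R *v (z + d))" by (simp add: d_def y)
  also have "\<dots> = z \<bullet> y + d \<bullet> (?R *v d)"
    using zd sR[of d z] by (simp add: mat_vec_simps inner_add zz inner_commute)
  finally have w: "w \<bullet> y = z \<bullet> y + d \<bullet> (?R *v d)" .
  have "(d \<bullet> (?R *v d))\<^sup>2 \<le> t\<^sup>2 * (d \<bullet> (?R *v d)) * (z \<bullet> y)"
    using skew_part_form_bound[OF X t, of d z] by (simp add: Rd[symmetric] re_mat_form y)
  then have "d \<bullet> (?R *v d) * (d \<bullet> (?R *v d)) \<le> d \<bullet> (?R *v d) * (t\<^sup>2 * (z \<bullet> y))"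
    by (simp add: power2_eq_square mult_ac)
  moreover have "0 \<le> d \<bullet> (?R *v d)" "0 \<le> z \<bullet> y"
    using strictly_accretive_nonneg[OF acc, of d] strictly_accretive_nonneg[OF acc, of z]
    by (simp_all add: re_mat_form y)
  ultimately have "d \<bullet> (?R *v d) \<le> t\<^sup>2 * (z \<bullet> y)"
    by (cases "d \<bullet> (?R *v d) = 0") auto
  then have "w \<bullet> y \<le> (1 + t\<^sup>2) * (z \<bullet> y)" using w by (simp add: algebra_simps)
  then show ?thesis by (simp add: z_def w_def inner_commute)
qed

section \<open>Inverses of positive definite matrices\<close>

lemma hermitian_matrix_inv:
  assumes "hermitian_mat A" and "invertible A"
  shows "hermitian_mat (matrix_inv A)"
proof -
  have "matrix_inv A = adjoint_mat (matrix_inv A)"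
  proof (rule matrix_inv_unique)
    have "adjoint_mat (matrix_inv A ** A) = mat 1" "adjoint_mat (A ** matrix_inv A) = mat 1"
      using assms(2) by (simp_all only: invertible_matrix_inv adjoint_mat_one)
    then show "A ** adjoint_mat (matrix_inv A) = mat 1" "adjoint_mat (matrix_inv A) ** A = mat 1"
      using assms(1) by (simp_all add: hermitian_mat_def)
  qed
  then show ?thesis by (simp add: hermitian_mat_def)
qed

lemma positive_definite_psd_op:
  assumes "hermitian_mat R" and "strictly_accretive R"
  shows "psd_op ((*v) R)"
  using assms by (simp add: psd_op_def hermitian_selfadj strictly_accretive_nonneg)

text \<open>The variational characterization of the inverse: \<open>y \<bullet> R\<^sup>-\<^sup>1 y\<close> is the maximum of the left-hand side over \<open>u\<close>. It bounds
the form of an inverse by expressions linear in \<open>R\<close>, which can be added and integrated.\<close>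

lemma inverse_form_ge:
  assumes R: "hermitian_mat R" "strictly_accretive R"
  shows "2 * (u \<bullet> y) - u \<bullet> (R *v u) \<le> y \<bullet> (matrix_inv R *v y)"
proof -
  define w where "w = matrix_inv R *v y"
  have w: "R *v w = y" using R by (simp add: w_def mat_vec_inverse strictly_accretive_invertible)
  have "0 \<le> (u + (- 1) *\<^sub>R w) \<bullet> (R *v (u + (- 1) *\<^sub>R w))"
    using strictly_accretive_nonneg[OF R(2)] .
  also have "\<dots> = u \<bullet> (R *v u) - 2 * (u \<bullet> y) + w \<bullet> y"
    by (subst selfadj_form_add[OF hermitian_selfadj[OF R(1)]]) (simp add: w)
  finally show ?thesis by (simp add: w_def inner_commute)
qed

section \<open>The integrals of the mean kernels\<close>

text \<open>The substitution \<open>t = s / (1 + s)\<close> carries the Beta integral from the unit interval to the half-line.\<close>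

lemma has_integral_Beta_half_line:
  fixes a b :: real
  assumes "0 < a" and "0 < b"
  shows "((\<lambda>s. s powr (a - 1) * (1 + s) powr - (a + b)) has_integral Beta a b) {0<..}"
proof -
  define f where "f t = t powr (a - 1) * (1 - t) powr (b - 1)" for t :: real
  define g where "g s = s / (1 + s)" for s :: real
  have f: "(f has_integral Beta a b) {0<..<1}"
    using has_integral_Beta_real[OF assms] by (simp add: f_def[abs_def] has_integral_Icc_iff_Ioo)
  then have "f absolutely_integrable_on {0<..<1}"
    by (intro nonnegative_absolutely_integrable_1) (auto simp: f_def has_integral_integrable)
  moreover have img: "g ` {0<..} = {0<..<1}"
  proof
    show "g ` {0<..} \<subseteq> {0<..<1}" by (auto simp: g_def field_simps)
    show "{0<..<1} \<subseteq> g ` {0<..}"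
    proof
      fix t :: real assume "t \<in> {0<..<1}"
      then have "t = g (t / (1 - t))" "t / (1 - t) \<in> {0<..}" by (auto simp: g_def field_simps)
      then show "t \<in> g ` {0<..}" by blast
    qed
  qed
  moreover have "(g has_field_derivative 1 / (1 + s)\<^sup>2) (at s within {0<..})" if "s \<in> {0<..}" for s
    unfolding g_def using that
    by (auto intro!: derivative_eq_intros simp: field_simps power2_eq_square)
  moreover have "inj_on g {0<..}"
    by (rule inj_onI) (simp add: g_def field_simps)
  ultimately have "(\<lambda>s. \<bar>1 / (1 + s)\<^sup>2\<bar> * f (g s)) absolutely_integrable_on {0<..} \<and>
      integral {0<..} (\<lambda>s. \<bar>1 / (1 + s)\<^sup>2\<bar> * f (g s)) = Beta a b"
    using f by (subst has_absolute_integral_change_of_variables_1'[where g = g]) (auto simp: integral_unique)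
  then have "((\<lambda>s. \<bar>1 / (1 + s)\<^sup>2\<bar> * f (g s)) has_integral Beta a b) {0<..}"
    using set_lebesgue_integral_eq_integral(1) by (metis has_integral_integral)
  moreover have "\<bar>1 / (1 + s)\<^sup>2\<bar> * f (g s) = s powr (a - 1) * (1 + s) powr - (a + b)"
    if "s \<in> {0<..}" for s
  proof -
    have s: "0 < s" using that by simp
    then have "1 - g s = (1 + s) powr - 1" by (simp add: g_def powr_minus field_simps)
    moreover have "g s = s * (1 + s) powr - 1" using s by (simp add: g_def powr_minus field_simps)
    moreover have "\<bar>1 / (1 + s)\<^sup>2\<bar> = (1 + s) powr - 2"
      using s by (simp add: powr_minus field_simps flip: powr_numeral)
    ultimately have "\<bar>1 / (1 + s)\<^sup>2\<bar> * f (g s) = (1 + s) powr - 2 * 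
        (s powr (a - 1) * (1 + s) powr (- 1 * (a - 1)) * (1 + s) powr (- 1 * (b - 1)))"
      using s by (simp only: f_def powr_powr powr_mult)
    also have "\<dots> = s powr (a - 1) * ((1 + s) powr - 2 * (1 + s) powr (- 1 * (a - 1)) * (1 + s) powr (- 1 * (b - 1)))"
      by simp
    also have "(1 + s) powr - 2 * (1 + s) powr (- 1 * (a - 1)) * (1 + s) powr (- 1 * (b - 1)) = (1 + s) powr - (a + b)"
      by (simp flip: powr_add)
    finally show ?thesis .
  qed
  ultimately show ?thesis by (rule has_integral_eq[rotated])
qed

lemma Gamma_reflection_real: "Gamma v * Gamma (1 - v) = pi / sin (v * pi)" for v :: real
proof -
  have "complex_of_real (Gamma v * Gamma (1 - v)) = of_real (pi / sin (v * pi))"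
    using Gamma_reflection_complex[of "of_real v"]
    by (simp add: mult.commute flip: Gamma_complex_of_real sin_of_real)
  then show ?thesis using of_real_eq_iff by blast
qed

text \<open>The three kernels have the total masses \<open>1\<close>, \<open>1 - v\<close> and \<open>v\<close>, up to the reciprocal of the constant
\<open>sin (v \<pi>) / \<pi>\<close> in front of the integral for the geometric mean. The third is the difference of the first two.\<close>

lemma mean_kernel_integrals:
  fixes v :: real
  assumes v: "0 < v" "v < 1"
  shows "((\<lambda>s. s powr (v - 1) / (1 + s)) has_integral pi / sin (v * pi)) {0<..}"
    and "((\<lambda>s. s powr (v - 1) / (1 + s)\<^sup>2) has_integral (1 - v) * (pi / sin (v * pi))) {0<..}"
    and "((\<lambda>s. s powr (v - 1) * s / (1 + s)\<^sup>2) has_integral v * (pi / sin (v * pi))) {0<..}"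
proof -
  have "Beta v (1 - v) = pi / sin (v * pi)" by (simp add: Beta_def Gamma_reflection_real)
  then show 1: "((\<lambda>s. s powr (v - 1) / (1 + s)) has_integral pi / sin (v * pi)) {0<..}"
    using v by (intro has_integral_eq[OF _ has_integral_Beta_half_line[of v "1 - v", THEN back_subst[of "\<lambda>z. (_ has_integral z) _"]]])
       (auto simp: powr_minus divide_inverse)
  have "Gamma (1 + (1 - v)) = (1 - v) * Gamma (1 - v)"
    using v by (subst add.commute, intro Gamma_plus1) auto
  then have "Beta v (2 - v) = (1 - v) * (pi / sin (v * pi))" 
    using Gamma_fact[of 1, where 'a = real] by (simp add: Beta_def flip: Gamma_reflection_real)
  then show 2: "((\<lambda>s. s powr (v - 1) / (1 + s)\<^sup>2) has_integral (1 - v) * (pi / sin (v * pi))) {0<..}"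
    using v by (intro has_integral_eq[OF _ has_integral_Beta_half_line[of v "2 - v", THEN back_subst[of "\<lambda>z. (_ has_integral z) _"]]])
       (auto simp: powr_minus divide_inverse)
  have "((\<lambda>s. s powr (v - 1) / (1 + s) - s powr (v - 1) / (1 + s)\<^sup>2) has_integral
      pi / sin (v * pi) - (1 - v) * (pi / sin (v * pi))) {0<..}"
    by (intro has_integral_diff 1 2)
  moreover have "pi / sin (v * pi) - (1 - v) * (pi / sin (v * pi)) = v * (pi / sin (v * pi))"
    by (simp only: left_diff_distrib)
  moreover have "s powr (v - 1) / (1 + s) - s powr (v - 1) / (1 + s)\<^sup>2 = s powr (v - 1) * s / (1 + s)\<^sup>2"
    if "s \<in> {0<..}" for s
  proof -
    have "s powr (v - 1) / (1 + s) = s powr (v - 1) * (1 + s) / (1 + s)\<^sup>2"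
      using that by (simp add: power2_eq_square)
    then show ?thesis by (simp add: distrib_left add_divide_distrib)
  qed
  ultimately show "((\<lambda>s. s powr (v - 1) * s / (1 + s)\<^sup>2) has_integral v * (pi / sin (v * pi))) {0<..}"
    by (metis (no_types, lifting) has_integral_eq)
qed

section \<open>Integrability of the resolvent\<close>

lemma strictly_accretive_common_lower_bound:
  fixes C D :: "complex^'n^'n"
  assumes C: "strictly_accretive C" and D: "strictly_accretive D"
  obtains \<mu> where "0 < \<mu>" "\<And>x. \<mu> * (x \<bullet> x) \<le> x \<bullet> (C *v x)" "\<And>x. \<mu> * (x \<bullet> x) \<le> x \<bullet> (D *v x)"
proof -
  obtain c d where c: "0 < c" "\<And>x. c * (x \<bullet> x) \<le> x \<bullet> (C *v x)"
    and d: "0 < d" "\<And>x. d * (x \<bullet> x) \<le> x \<bullet> (D *v x)"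
    using strictly_accretive_lower_bound[OF C] strictly_accretive_lower_bound[OF D] by metis
  define \<mu> where "\<mu> = min c d"
  have \<mu>: "0 < \<mu>" "\<mu> * (x \<bullet> x) \<le> x \<bullet> (C *v x)" "\<mu> * (x \<bullet> x) \<le> x \<bullet> (D *v x)" for x
    using c d mult_right_mono[of \<mu> c "x \<bullet> x"] mult_right_mono[of \<mu> d "x \<bullet> x"]
    by (auto simp: \<mu>_def intro: order_trans)
  from \<mu> show thesis by (rule that)
qed

lemma resolvent_vec_bound:
  fixes C D :: "complex^'n^'n"
  assumes \<mu>: "0 < \<mu>" "\<And>x. \<mu> * (x \<bullet> x) \<le> x \<bullet> (C *v x)" "\<And>x. \<mu> * (x \<bullet> x) \<le> x \<bullet> (D *v x)"
    and s: "0 < s" and inv: "invertible (C + s *\<^sub>R D)"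
  shows "norm (matrix_inv (C + s *\<^sub>R D) *v y) \<le> norm y / (\<mu> * (1 + s))"
proof -
  define z where "z = matrix_inv (C + s *\<^sub>R D) *v y"
  have z: "(C + s *\<^sub>R D) *v z = y" using inv by (simp add: z_def mat_vec_inverse)
  have "\<mu> * (1 + s) * (norm z)\<^sup>2 = \<mu> * (z \<bullet> z) + s * (\<mu> * (z \<bullet> z))"
    by (simp add: algebra_simps power2_norm_eq_inner)
  also have "\<dots> \<le> z \<bullet> (C *v z) + s * (z \<bullet> (D *v z))"
    using \<mu> s by (intro add_mono mult_left_mono) auto
  also have "\<dots> = z \<bullet> y" unfolding z[symmetric] by (simp add: mat_vec_simps inner_add)
  also have "\<dots> \<le> norm z * norm y" by (rule norm_cauchy_schwarz)
  finally have "norm z * (\<mu> * (1 + s) * norm z) \<le> norm z * norm y"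
    by (simp add: power2_eq_square mult_ac)
  then have "\<mu> * (1 + s) * norm z \<le> norm y" by (cases "z = 0") auto
  then show ?thesis using \<mu>(1) s by (simp add: pos_le_divide_eq mult.commute flip: z_def)
qed

lemma mat_nth_eq_vec: "A $ i $ j = (A *v axis j 1) $ i" for A :: "complex^'n^'m"
  by (simp add: matrix_vector_mult_def axis_def if_distrib cong: if_cong)

text \<open>By the resolvent identity \<open>J\<^sub>s - J\<^sub>r = J\<^sub>s (r - s) D J\<^sub>r\<close>, with \<open>J\<^sub>s = (C + s D)\<^sup>-\<^sup>1\<close>, each \<open>s \<mapsto> J\<^sub>s y\<close> is even Lipschitz.
This is needed for the measurability of the integrand.\<close>

lemma continuous_on_resolvent:
  fixes C D :: "complex^'n^'n"
  assumes C: "strictly_accretive C" and D: "strictly_accretive D"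
  shows "continuous_on {0<..} (\<lambda>s. matrix_inv (C + s *\<^sub>R D))"
proof -
  let ?J = "\<lambda>s. matrix_inv (C + s *\<^sub>R D)"
  obtain \<mu> where \<mu>: "0 < \<mu>" "\<And>x. \<mu> * (x \<bullet> x) \<le> x \<bullet> (C *v x)" "\<And>x. \<mu> * (x \<bullet> x) \<le> x \<bullet> (D *v x)"
    using strictly_accretive_common_lower_bound[OF C D] by metis
  have inv: "invertible (C + s *\<^sub>R D)" if "0 < s" for s
    using that C D by (intro strictly_accretive_invertible strictly_accretive_add strictly_accretive_scaleR)
  have bd: "norm (?J s *v y) \<le> norm y / \<mu>" if "0 < s" for s y
  proof -
    have "norm (?J s *v y) \<le> norm y / (\<mu> * (1 + s))"
      using \<mu> that by (intro resolvent_vec_bound inv)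
    also have "\<dots> \<le> norm y / (\<mu> * 1)" using \<mu>(1) that by (intro divide_left_mono mult_left_mono) auto
    finally show ?thesis by simp
  qed
  obtain L where L: "0 < L" "\<And>x. norm (D *v x) \<le> norm x * L"
    using bounded_linear.pos_bounded[OF matrix_vector_mul_bounded_linear[of D]] by blast
  have "continuous_on {0<..} (\<lambda>s. ?J s *v y)" for y
  proof (rule lipschitz_on_continuous_on)
    show "(norm y * L / \<mu>\<^sup>2)-lipschitz_on {0<..} (\<lambda>s. ?J s *v y)"
    proof (rule lipschitz_onI)
      fix s r :: real assume "s \<in> {0<..}" "r \<in> {0<..}"
      then have s: "0 < s" "0 < r" by auto
      have "?J s *v y - ?J r *v y = ?J s *v (y - (C + s *\<^sub>R D) *v (?J r *v y))"
        using inv[OF s(1)] by (simp only: matrix_vector_mult_diff_distrib mat_vec_inverse)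
      also have "y - (C + s *\<^sub>R D) *v (?J r *v y) = (C + r *\<^sub>R D) *v (?J r *v y) - (C + s *\<^sub>R D) *v (?J r *v y)"
        using inv[OF s(2)] by (simp only: mat_vec_inverse)
      also have "\<dots> = (r - s) *\<^sub>R (D *v (?J r *v y))" by (simp add: mat_vec_simps algebra_simps)
      finally have "norm (?J s *v y - ?J r *v y) \<le> norm ((r - s) *\<^sub>R (D *v (?J r *v y))) / \<mu>"
        using bd[OF s(1), of "(r - s) *\<^sub>R (D *v (?J r *v y))"] by (simp only:)
      also have "\<dots> \<le> \<bar>r - s\<bar> * ((norm y / \<mu>) * L) / \<mu>"
        unfolding norm_scaleR using \<mu>(1) L(1) bd[OF s(2), of y]
        by (intro divide_right_mono mult_left_mono order_trans[OF L(2)] mult_right_mono) auto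
      finally show "dist (?J s *v y) (?J r *v y) \<le> norm y * L / \<mu>\<^sup>2 * dist s r"
        by (simp add: dist_norm power2_eq_square mult_ac abs_minus_commute)
    qed (use \<mu>(1) L(1) in auto)
  qed
  then have "continuous_on {0<..} (\<lambda>s. \<chi> i j. (?J s *v axis j 1) $ i)"
    by (intro continuous_intros)
  then show ?thesis by (simp flip: mat_nth_eq_vec)
qed

lemma norm_matrix_le_sum: "norm A \<le> (\<Sum>i\<in>UNIV. \<Sum>j\<in>UNIV. norm (A $ i $ j))"
  for A :: "complex^'n^'m"
proof -
  have le: "norm x \<le> (\<Sum>i\<in>UNIV. norm (x $ i))" for x :: "'b::real_normed_vector ^ 'c"
    unfolding norm_vec_def by (rule L2_set_le_sum) simp
  have "norm A \<le> (\<Sum>i\<in>UNIV. norm (A $ i))" by (rule le)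
  also have "\<dots> \<le> (\<Sum>i\<in>UNIV. \<Sum>j\<in>UNIV. norm (A $ i $ j))" by (intro sum_mono le)
  finally show ?thesis .
qed

text \<open>The integrand is dominated by a multiple of \<open>s\<^bsup>v-1\<^esup> / (1 + s)\<close>.\<close>

lemma geom_mean_integrand_integrable:
  fixes C D :: "complex^'n^'n"
  assumes C: "strictly_accretive C" and D: "strictly_accretive D" and v: "0 < v" "v < 1"
  shows "(\<lambda>s. (s powr (v - 1)) *\<^sub>R matrix_inv (C + s *\<^sub>R D)) integrable_on {0<..}"
proof -
  let ?J = "\<lambda>s. matrix_inv (C + s *\<^sub>R D)"
  obtain \<mu> where \<mu>: "0 < \<mu>" "\<And>x. \<mu> * (x \<bullet> x) \<le> x \<bullet> (C *v x)" "\<And>x. \<mu> * (x \<bullet> x) \<le> x \<bullet> (D *v x)"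
    using strictly_accretive_common_lower_bound[OF C D] by metis
  have inv: "invertible (C + s *\<^sub>R D)" if "0 < s" for s
    using that C D by (intro strictly_accretive_invertible strictly_accretive_add strictly_accretive_scaleR)
  define k where "k = (\<Sum>i\<in>(UNIV :: 'n set). \<Sum>j\<in>UNIV. norm (axis j 1 :: complex^'n) / \<mu>)"
  have bd: "norm (?J s) \<le> k / (1 + s)" if "0 < s" for s
  proof -
    have "norm (?J s) \<le> (\<Sum>i\<in>UNIV. \<Sum>j\<in>UNIV. norm (?J s $ i $ j))" by (rule norm_matrix_le_sum)
    also have "\<dots> \<le> (\<Sum>i\<in>(UNIV :: 'n set). \<Sum>j\<in>UNIV. norm (axis j 1 :: complex^'n) / (\<mu> * (1 + s)))"
      unfolding mat_nth_eq_vec[of "?J s"] using \<mu> that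
      by (intro sum_mono order_trans[OF Finite_Cartesian_Product.norm_nth_le] resolvent_vec_bound inv)
    also have "\<dots> = k / (1 + s)" by (simp add: k_def sum_divide_distrib)
    finally show ?thesis .
  qed
  show ?thesis
  proof (rule measurable_bounded_by_integrable_imp_integrable)
    show "(\<lambda>s. (s powr (v - 1)) *\<^sub>R ?J s) \<in> borel_measurable (lebesgue_on {0<..})"
      by (intro continuous_imp_measurable_on_sets_lebesgue continuous_on_scaleR continuous_on_resolvent C D)
         (auto intro!: continuous_intros)
    show "(\<lambda>s. (s powr (v - 1) / (1 + s)) * k) integrable_on {0<..}"
      using mean_kernel_integrals(1)[OF v] by (intro integrable_on_mult_left) (rule has_integral_integrable)
    show "norm ((s powr (v - 1)) *\<^sub>R ?J s) \<le> s powr (v - 1) / (1 + s) * k" if "s \<in> {0<..}" for s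
    proof -
      have "norm ((s powr (v - 1)) *\<^sub>R ?J s) \<le> s powr (v - 1) * (k / (1 + s))"
        unfolding norm_scaleR using mult_left_mono[OF bd, of s "s powr (v - 1)"] that by simp
      then show ?thesis by simp
    qed
  qed auto
qed

section \<open>Bounds for the weighted geometric mean\<close>

lemma bounded_linear_form: "bounded_linear (\<lambda>X :: complex^'n^'n. y \<bullet> (X *v y))"
  by (rule linear_conv_bounded_linear[THEN iffD1]) (auto simp: linear_iff mat_vec_simps inner_add)

text \<open>The defining integral commutes with the evaluation of a quadratic form, so all later comparisons are between
real integrals.\<close>

lemma has_integral_geom_mean_form:
  fixes A B :: "complex^'n^'n"
  assumes A: "strictly_accretive A" and B: "strictly_accretive B" and v: "0 < v" "v < 1"
  shows "((\<lambda>s. s powr (v - 1) * (y \<bullet> (matrix_inv (matrix_inv A + s *\<^sub>R matrix_inv B) *v y)))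
    has_integral (y \<bullet> (geom_mean v A B *v y)) * (pi / sin (v * pi))) {0<..}"
proof -
  let ?f = "\<lambda>s. (s powr (v - 1)) *\<^sub>R matrix_inv (matrix_inv A + s *\<^sub>R matrix_inv B)"
  have "(?f has_integral integral {0<..} ?f) {0<..}"
    using assms by (intro integrable_integral geom_mean_integrand_integrable strictly_accretive_matrix_inv)
  from has_integral_linear[OF this bounded_linear_form[of y]]
  have "((\<lambda>s. s powr (v - 1) * (y \<bullet> (matrix_inv (matrix_inv A + s *\<^sub>R matrix_inv B) *v y)))
    has_integral (y \<bullet> (integral {0<..} ?f *v y))) {0<..}"
    by (simp add: o_def mat_vec_simps)
  moreover have "0 < sin (v * pi)" using v by (intro sin_gt_zero) auto
  then have "y \<bullet> (integral {0<..} ?f *v y) = (y \<bullet> (geom_mean v A B *v y)) * (pi / sin (v * pi))"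
    using v by (simp add: geom_mean_def mat_vec_simps)
  ultimately show ?thesis by simp
qed

text \<open>Let \<open>C = A\<^sup>-\<^sup>1\<close>, \<open>D = B\<^sup>-\<^sup>1\<close>. For \<open>z = (C + s D)\<^sup>-\<^sup>1 y\<close> the form of the integrand is \<open>z \<bullet> y = z \<bullet> C z + s (z \<bullet> D z)\<close>. The
variational lower bounds for \<open>p = y \<bullet> (Re C)\<^sup>-\<^sup>1 y\<close> and \<open>q = y \<bullet> (Re D)\<^sup>-\<^sup>1 y\<close> at the test vector
\<open>(1 + s) z\<close> add up, with weights \<open>1\<close> and \<open>s\<close>, to \<open>(1 + s)\<^sup>2 (z \<bullet> y) \<le> p + s q\<close>. This is operator convexity of inversion in a form
that accepts non-Hermitian matrices; it integrates to the claim.\<close>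

lemma geom_mean_form_le:
  fixes A B :: "complex^'n^'n"
  assumes A: "strictly_accretive A" and B: "strictly_accretive B" and v: "0 \<le> v" "v \<le> 1"
  shows "y \<bullet> (geom_mean v A B *v y) \<le>
    (1 - v) * (y \<bullet> (matrix_inv (re_mat (matrix_inv A)) *v y)) + v * (y \<bullet> (matrix_inv (re_mat (matrix_inv B)) *v y))"
proof -
  define C D where "C = matrix_inv A" and "D = matrix_inv B"
  have CD: "strictly_accretive C" "strictly_accretive D"
    using A B by (simp_all add: C_def D_def strictly_accretive_matrix_inv)
  define p q where "p = matrix_inv (re_mat C) *v y" and "q = matrix_inv (re_mat D) *v y"
  consider "v = 0" | "v = 1" | "0 < v" "v < 1" using v by linarith
  then have "y \<bullet> (geom_mean v A B *v y) \<le> (1 - v) * (y \<bullet> p) + v * (y \<bullet> q)"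
  proof cases
    case 1
    have "matrix_inv C = A" using A by (simp add: C_def matrix_inv_matrix_inv strictly_accretive_invertible)
    then show ?thesis using re_mat_inverse_le[OF CD(1), of y] 1 by (simp add: geom_mean_def p_def)
  next
    case 2
    have "matrix_inv D = B" using B by (simp add: D_def matrix_inv_matrix_inv strictly_accretive_invertible)
    then show ?thesis using re_mat_inverse_le[OF CD(2), of y] 2 by (simp add: geom_mean_def q_def)
  next
    case 3
    define k where "k = pi / sin (v * pi)"
    have k: "0 < k" unfolding k_def using 3 by (intro divide_pos_pos sin_gt_zero) auto
    have pt: "y \<bullet> (matrix_inv (C + s *\<^sub>R D) *v y) \<le> (y \<bullet> p + s * (y \<bullet> q)) / (1 + s)\<^sup>2" if s: "0 < s" for s
    proof -
      define z where "z = matrix_inv (C + s *\<^sub>R D) *v y"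
      have "invertible (C + s *\<^sub>R D)"
        using s CD by (intro strictly_accretive_invertible strictly_accretive_add strictly_accretive_scaleR)
      then have z: "(C + s *\<^sub>R D) *v z = y" by (simp add: z_def mat_vec_inverse)
      define t where "t = 1 + s"
      have t: "0 < t" using s by (simp add: t_def)
      have low: "2 * t * (z \<bullet> y) - t\<^sup>2 * (z \<bullet> (X *v z)) \<le> y \<bullet> (matrix_inv (re_mat X) *v y)"
        if "strictly_accretive X" for X
        using inverse_form_ge[of "re_mat X" "t *\<^sub>R z" y] that
        by (simp add: hermitian_re_mat strictly_accretive_re_mat re_mat_form mat_vec_simps power2_eq_square)
      have "(2 * t * (z \<bullet> y) - t\<^sup>2 * (z \<bullet> (C *v z))) + s * (2 * t * (z \<bullet> y) - t\<^sup>2 * (z \<bullet> (D *v z)))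
          \<le> y \<bullet> p + s * (y \<bullet> q)"
        unfolding p_def q_def using s CD by (intro add_mono mult_left_mono low) auto
      moreover have "(2 * t * (z \<bullet> y) - t\<^sup>2 * (z \<bullet> (C *v z))) + s * (2 * t * (z \<bullet> y) - t\<^sup>2 * (z \<bullet> (D *v z)))
          = 2 * t * t * (z \<bullet> y) - t\<^sup>2 * (z \<bullet> (C *v z) + s * (z \<bullet> (D *v z)))"
        by (simp add: t_def algebra_simps)
      moreover have "z \<bullet> (C *v z) + s * (z \<bullet> (D *v z)) = z \<bullet> y"
        unfolding z[symmetric] by (simp add: mat_vec_simps inner_add)
      ultimately have "t\<^sup>2 * (z \<bullet> y) \<le> y \<bullet> p + s * (y \<bullet> q)" by (simp add: power2_eq_square)
      then show ?thesis using t by (simp add: t_def[symmetric] z_def[symmetric] inner_commute field_simps)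
    qed
    have "((\<lambda>s. (y \<bullet> p) * (s powr (v - 1) / (1 + s)\<^sup>2) + (y \<bullet> q) * (s powr (v - 1) * s / (1 + s)\<^sup>2))
      has_integral (y \<bullet> p) * ((1 - v) * k) + (y \<bullet> q) * (v * k)) {0<..}"
      unfolding k_def using 3 by (intro has_integral_add has_integral_mult_right mean_kernel_integrals)
    then have "(y \<bullet> (geom_mean v A B *v y)) * k \<le> (y \<bullet> p) * ((1 - v) * k) + (y \<bullet> q) * (v * k)"
    proof (rule has_integral_le[OF has_integral_geom_mean_form[OF A B 3, of y, folded k_def C_def D_def]])
      fix s :: real assume "s \<in> {0<..}"
      then have "s powr (v - 1) * (y \<bullet> (matrix_inv (C + s *\<^sub>R D) *v y))
          \<le> s powr (v - 1) * ((y \<bullet> p + s * (y \<bullet> q)) / (1 + s)\<^sup>2)"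
        by (intro mult_left_mono pt) auto
      then show "s powr (v - 1) * (y \<bullet> (matrix_inv (C + s *\<^sub>R D) *v y))
          \<le> (y \<bullet> p) * (s powr (v - 1) / (1 + s)\<^sup>2) + (y \<bullet> q) * (s powr (v - 1) * s / (1 + s)\<^sup>2)"
        by (simp add: algebra_simps add_divide_distrib)
    qed
    then have "(y \<bullet> (geom_mean v A B *v y)) * k \<le> ((1 - v) * (y \<bullet> p) + v * (y \<bullet> q)) * k"
      by (simp add: algebra_simps)
    then show ?thesis using k by simp
  qed
  then show ?thesis by (simp add: p_def q_def C_def D_def)
qed

text \<open>Let \<open>X = A\<^sup>-\<^sup>1 + s B\<^sup>-\<^sup>1\<close>. The integrand satisfies \<open>(1 + t\<^sup>2) Re (X\<^sup>-\<^sup>1) \<ge> (Re X)\<^sup>-\<^sup>1\<close>, and the form of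
\<open>(Re X)\<^sup>-\<^sup>1\<close> is bounded below variationally with the test vector \<open>u / (1 + s)\<close>. Since
\<open>Re (A\<^sup>-\<^sup>1) \<le> (Re A)\<^sup>-\<^sup>1\<close>, and likewise for \<open>B\<close>, integration gives the claim. The supremum of the left-hand
side over \<open>u\<close> is the form of the weighted harmonic mean of \<open>Re A\<close> and \<open>Re B\<close>; keeping \<open>u\<close> free avoids
that mean altogether.\<close>

lemma geom_mean_form_ge:
  fixes A B :: "complex^'n^'n"
  assumes A: "sectorial t A" and B: "sectorial t B" and t: "0 \<le> t" and v: "0 \<le> v" "v \<le> 1"
  shows "2 * (y \<bullet> u) - ((1 - v) * (u \<bullet> (matrix_inv (re_mat A) *v u)) + v * (u \<bullet> (matrix_inv (re_mat B) *v u)))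
    \<le> (1 + t\<^sup>2) * (y \<bullet> (geom_mean v A B *v y))"
proof -
  have acc: "strictly_accretive A" "strictly_accretive B" using A B by (auto simp: sectorial_def)
  have end_case: "2 * (y \<bullet> u) - u \<bullet> (matrix_inv (re_mat X) *v u) \<le> (1 + t\<^sup>2) * (y \<bullet> (X *v y))"
    if X: "strictly_accretive X" for X
  proof -
    have R: "hermitian_mat (re_mat X)" "strictly_accretive (re_mat X)" "invertible (re_mat X)"
      using X by (simp_all add: hermitian_re_mat strictly_accretive_re_mat strictly_accretive_invertible)
    have "2 * (u \<bullet> y) - u \<bullet> (matrix_inv (re_mat X) *v u) \<le> y \<bullet> (matrix_inv (matrix_inv (re_mat X)) *v y)"
      using R by (intro inverse_form_ge hermitian_matrix_inv strictly_accretive_matrix_inv)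
    then have "2 * (y \<bullet> u) - u \<bullet> (matrix_inv (re_mat X) *v u) \<le> 1 * (y \<bullet> (X *v y))"
      using R by (simp add: matrix_inv_matrix_inv re_mat_form inner_commute)
    also have "\<dots> \<le> (1 + t\<^sup>2) * (y \<bullet> (X *v y))"
      using strictly_accretive_nonneg[OF X, of y] by (intro mult_right_mono) auto
    finally show ?thesis .
  qed
  define C D where "C = matrix_inv A" and "D = matrix_inv B"
  have CD: "sectorial t C" "sectorial t D" "strictly_accretive C" "strictly_accretive D"
    using A B acc by (simp_all add: C_def D_def sectorial_matrix_inv strictly_accretive_matrix_inv)
  define a b where "a = u \<bullet> (matrix_inv (re_mat A) *v u)" and "b = u \<bullet> (matrix_inv (re_mat B) *v u)"
  have Ca: "u \<bullet> (C *v u) \<le> a" and Db: "u \<bullet> (D *v u) \<le> b"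
    using acc by (simp_all add: C_def D_def a_def b_def re_mat_inverse_le)
  consider "v = 0" | "v = 1" | "0 < v" "v < 1" using v by linarith
  then have "2 * (y \<bullet> u) - ((1 - v) * a + v * b) \<le> (1 + t\<^sup>2) * (y \<bullet> (geom_mean v A B *v y))"
  proof cases
    case 1
    then show ?thesis using end_case[OF acc(1)] by (simp add: geom_mean_def a_def)
  next
    case 2
    then show ?thesis using end_case[OF acc(2)] by (simp add: geom_mean_def b_def)
  next
    case 3
    define k where "k = pi / sin (v * pi)"
    have k: "0 < k" unfolding k_def using 3 by (intro divide_pos_pos sin_gt_zero) auto
    have pt: "2 * (y \<bullet> u) / (1 + s) - (a + s * b) / (1 + s)\<^sup>2 
        \<le> (1 + t\<^sup>2) * (y \<bullet> (matrix_inv (C + s *\<^sub>R D) *v y))" if s: "0 < s" for s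
    proof -
      define X where "X = C + s *\<^sub>R D"
      have X: "sectorial t X" unfolding X_def using s CD by (intro sectorial_add sectorial_scaleR)
      then have acX: "strictly_accretive (re_mat X)" by (simp add: sectorial_def strictly_accretive_re_mat)
      define r where "r = 1 / (1 + s)"
      have "2 * r * (y \<bullet> u) - r\<^sup>2 * (a + s * b) \<le> 2 * r * (y \<bullet> u) - r\<^sup>2 * (u \<bullet> (C *v u) + s * (u \<bullet> (D *v u)))"
        using Ca Db s by (intro diff_left_mono mult_left_mono add_mono) auto
      also have "\<dots> = 2 * ((r *\<^sub>R u) \<bullet> y) - (r *\<^sub>R u) \<bullet> (re_mat X *v (r *\<^sub>R u))"
        by (simp add: re_mat_form X_def mat_vec_simps inner_add inner_commute power2_eq_square algebra_simps)
      also have "\<dots> \<le> y \<bullet> (matrix_inv (re_mat X) *v y)"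
        using acX by (intro inverse_form_ge hermitian_re_mat)
      also have "\<dots> \<le> (1 + t\<^sup>2) * (y \<bullet> (matrix_inv X *v y))"
        by (rule inverse_re_mat_le[OF X t])
      finally show ?thesis by (simp add: X_def r_def power_divide)
    qed
    have "((\<lambda>s. 2 * (y \<bullet> u) * (s powr (v - 1) / (1 + s)) - 
        (a * (s powr (v - 1) / (1 + s)\<^sup>2) + b * (s powr (v - 1) * s / (1 + s)\<^sup>2)))
      has_integral 2 * (y \<bullet> u) * k - (a * ((1 - v) * k) + b * (v * k))) {0<..}"
      unfolding k_def using 3 by (intro has_integral_add has_integral_diff has_integral_mult_right mean_kernel_integrals)
    then have "2 * (y \<bullet> u) * k - (a * ((1 - v) * k) + b * (v * k)) \<le> (1 + t\<^sup>2) * ((y \<bullet> (geom_mean v A B *v y)) * k)"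
    proof (rule has_integral_le[OF _ has_integral_mult_right[OF 
          has_integral_geom_mean_form[OF acc 3, of y, folded k_def C_def D_def], of "1 + t\<^sup>2"]])
      fix s :: real assume "s \<in> {0<..}"
      then have "s powr (v - 1) * (2 * (y \<bullet> u) / (1 + s) - (a + s * b) / (1 + s)\<^sup>2)
          \<le> s powr (v - 1) * ((1 + t\<^sup>2) * (y \<bullet> (matrix_inv (C + s *\<^sub>R D) *v y)))"
        by (intro mult_left_mono pt) auto
      then show "2 * (y \<bullet> u) * (s powr (v - 1) / (1 + s)) - 
          (a * (s powr (v - 1) / (1 + s)\<^sup>2) + b * (s powr (v - 1) * s / (1 + s)\<^sup>2))
          \<le> (1 + t\<^sup>2) * (s powr (v - 1) * (y \<bullet> (matrix_inv (C + s *\<^sub>R D) *v y)))"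
        by (simp add: right_diff_distrib distrib_left add_divide_distrib mult_ac)
    qed
    then have "(2 * (y \<bullet> u) - ((1 - v) * a + v * b)) * k \<le> ((1 + t\<^sup>2) * (y \<bullet> (geom_mean v A B *v y))) * k"
      by (simp add: algebra_simps)
    then show ?thesis using k by simp
  qed
  then show ?thesis by (simp add: a_def b_def)
qed

section \<open>Positive unital linear maps\<close>

definition outer_square :: "complex^'n \<Rightarrow> complex^'n^'n" where
  "outer_square e = (\<chi> i j. e $ i * cnj (e $ j))"

lemma outer_square_mult: "outer_square e *v x = cdot e x *s e"
  by (simp add: outer_square_def matrix_vector_mult_def cdot_def vec_eq_iff sum_distrib_left mult_ac)

lemma psd_outer_square: "psd_mat (outer_square e)"
proof -
  have "Re (cdot x (outer_square e *v x)) = (cmod (cdot e x))\<^sup>2" for x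
    by (simp add: outer_square_mult cdot_scale_right cdot_commute[of x e] flip: complex_norm_square)
  then show ?thesis
    by (simp add: psd_mat_def hermitian_mat_def outer_square_def adjoint_mat_def vec_eq_iff mult.commute)
qed

lemma sum_mat_vec: "(\<Sum>b\<in>S. F b) *v x = (\<Sum>b\<in>S. F b *v x)" for F :: "'a \<Rightarrow> complex^'n^'m"
  by (induction S rule: infinite_finite_induct) (simp_all add: mat_vec_simps)

text \<open>The basis \<open>B\<close> is orthonormal for the real inner product. It has twice as many elements as a complex
orthonormal basis, which is the origin of the factor \<open>2\<close>: the complex coefficient of \<open>x\<close> along \<open>b\<close> consists of the
real coefficients of \<open>x\<close> and of \<open>- \<i> x\<close>, and each of the two contributes one copy of \<open>Z x\<close>.\<close>

lemma sum_outer_square_eigenbasis: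
  fixes Z :: "complex^'n^'n"
  assumes B: "\<And>x. (\<Sum>b\<in>B. (b \<bullet> x) *\<^sub>R b) = x" and Z: "\<And>b. b \<in> B \<Longrightarrow> Z *v b = c b *\<^sub>R b"
  shows "(\<Sum>b\<in>B. c b *\<^sub>R outer_square b) = 2 *\<^sub>R Z"
proof -
  have Zx: "(\<Sum>b\<in>B. ((b \<bullet> x) * c b) *\<^sub>R b) = Z *v x" for x
  proof -
    have "Z *v x = Z *v (\<Sum>b\<in>B. (b \<bullet> x) *\<^sub>R b)" by (simp add: B)
    also have "\<dots> = (\<Sum>b\<in>B. (b \<bullet> x) *\<^sub>R (Z *v b))"
      by (simp add: linear_sum[OF matrix_vector_mul_linear] mat_vec_simps)
    finally show ?thesis by (simp add: Z)
  qed
  have "(\<Sum>b\<in>B. c b *\<^sub>R outer_square b) *v x = (2 *\<^sub>R Z) *v x" for x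
  proof -
    define x' where "x' = (- \<i>) *s x"
    have cd: "cdot b x = of_real (b \<bullet> x) + \<i> * of_real (b \<bullet> x')" for b
      unfolding Re_cdot[symmetric] x'_def cdot_scale_right by (simp add: complex_eq_iff)
    have "c b *\<^sub>R (outer_square b *v x) = ((b \<bullet> x) * c b) *\<^sub>R b + \<i> *s (((b \<bullet> x') * c b) *\<^sub>R b)" for b
      unfolding outer_square_mult cd by (simp add: vec_eq_iff scaleR_conv_of_real[where 'a = complex] algebra_simps)
    then have "(\<Sum>b\<in>B. c b *\<^sub>R outer_square b) *v x =
        (\<Sum>b\<in>B. ((b \<bullet> x) * c b) *\<^sub>R b) + \<i> *s (\<Sum>b\<in>B. ((b \<bullet> x') * c b) *\<^sub>R b)"
      by (simp add: sum_mat_vec scaleR_mat_vec sum.distrib vec.scale_sum_right)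
    also have "\<dots> = Z *v x + \<i> *s (Z *v x')" by (simp only: Zx)
    also have "\<dots> = 2 *\<^sub>R (Z *v x)"
      unfolding x'_def vector_scalar_commute by (simp add: vec_eq_iff scaleR_conv_of_real[where 'a = complex])
    finally show ?thesis by (simp add: scaleR_mat_vec)
  qed
  then show ?thesis by (simp add: matrix_eq)
qed

locale positive_unital_map =
  fixes \<Phi> :: "complex^'n^'n \<Rightarrow> complex^'k^'k"
  assumes positive_unital_linear_map: "positive_unital_linear_map \<Phi>"
begin

lemma map_psd: "psd_mat X \<Longrightarrow> psd_mat (\<Phi> X)"
  and map_one: "\<Phi> (mat 1) = mat 1"
  using positive_unital_linear_map by (auto simp: positive_unital_linear_map_def)

lemma map_add: "\<Phi> (X + Y) = \<Phi> X + \<Phi> Y"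
  and map_diff: "\<Phi> (X - Y) = \<Phi> X - \<Phi> Y"
  and map_zero: "\<Phi> 0 = 0"
  and map_scaleR: "\<Phi> (r *\<^sub>R X) = r *\<^sub>R \<Phi> X"
proof -
  interpret P: Vector_Spaces.linear cscale_mat cscale_mat \<Phi>
    using positive_unital_linear_map by (simp add: positive_unital_linear_map_def)
  show "\<Phi> (X + Y) = \<Phi> X + \<Phi> Y" "\<Phi> (X - Y) = \<Phi> X - \<Phi> Y" "\<Phi> 0 = 0" 
    by (fact P.add P.diff P.zero)+
  have r: "cscale_mat (of_real r) A = r *\<^sub>R A" for A :: "complex^'i^'j"
    by (simp add: cscale_mat_def vec_eq_iff scaleR_conv_of_real[where 'a = complex])
  show "\<Phi> (r *\<^sub>R X) = r *\<^sub>R \<Phi> X" using P.scale[of "of_real r" X] by (simp only: r)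
qed

lemma map_sum: "\<Phi> (\<Sum>b\<in>S. F b) = (\<Sum>b\<in>S. \<Phi> (F b))"
  by (induction S rule: infinite_finite_induct) (simp_all add: map_zero map_add)

lemma map_form_mono:
  assumes "hermitian_mat X" and "hermitian_mat Y" and "\<And>x. x \<bullet> (X *v x) \<le> x \<bullet> (Y *v x)"
  shows "x \<bullet> (\<Phi> X *v x) \<le> x \<bullet> (\<Phi> Y *v x)"
proof -
  have "X \<le>\<^sub>L Y" using assms by (simp add: loewner_le_iff)
  then have "\<Phi> X \<le>\<^sub>L \<Phi> Y" by (simp add: loewner_le_def map_psd flip: map_diff)
  then show ?thesis by (rule loewner_leD)
qed

text \<open>Adding a large multiple of the identity makes a Hermitian matrix positive semidefinite.\<close>

lemma map_hermitian:
  assumes "hermitian_mat X"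
  shows "hermitian_mat (\<Phi> X)"
proof -
  obtain K where K: "\<And>x. norm (X *v x) \<le> norm x * K"
    using bounded_linear.bounded[OF matrix_vector_mul_bounded_linear[of X]] by blast
  have "0 \<le> x \<bullet> ((X + K *\<^sub>R mat 1) *v x)" for x
  proof -
    have "- (x \<bullet> (X *v x)) \<le> norm x * norm (X *v x)"
      using Cauchy_Schwarz_ineq2[of x "X *v x"] by linarith
    also have "\<dots> \<le> norm x * (norm x * K)" by (intro mult_left_mono K) simp
    also have "\<dots> = K * (x \<bullet> x)" by (simp add: dot_square_norm power2_eq_square)
    finally show ?thesis by (simp add: mat_vec_simps inner_add)
  qed
  then have "psd_mat (X + K *\<^sub>R mat 1)"
    using assms by (simp add: psd_mat_def Re_cdot hermitian_mat_def)
  from map_psd[OF this] show ?thesis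
    by (simp add: psd_mat_def hermitian_mat_def map_add map_scaleR map_one)
qed

lemma map_positive_definite:
  assumes Y: "hermitian_mat Y" "strictly_accretive Y"
  shows "strictly_accretive (\<Phi> Y)"
proof -
  obtain \<mu> where \<mu>: "0 < \<mu>" "\<And>x. \<mu> * (x \<bullet> x) \<le> x \<bullet> (Y *v x)"
    using strictly_accretive_lower_bound[OF Y(2)] by metis
  have "x \<bullet> (\<Phi> (\<mu> *\<^sub>R mat 1) *v x) \<le> x \<bullet> (\<Phi> Y *v x)" for x
    using \<mu> Y by (intro map_form_mono) (auto simp: hermitian_mat_def mat_vec_simps)
  then have "\<mu> * (x \<bullet> x) \<le> x \<bullet> (\<Phi> Y *v x)" for x
    by (simp add: map_scaleR map_one mat_vec_simps)
  then show ?thesis using \<mu>(1) unfolding strictly_accretive_def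
    by (meson inner_gt_zero_iff less_le_trans mult_pos_pos)
qed

text \<open>Positivity of the block matrix with diagonal \<open>\<Phi>(Y)\<close>, \<open>\<Phi>(Y\<^sup>-\<^sup>1)\<close> and identity off the diagonal, up to a sign. The
spectral decomposition writes \<open>Y\<close>, \<open>Y\<^sup>-\<^sup>1\<close> and the identity as sums of the same positive matrices of rank one,
with coefficients \<open>c\<close>, \<open>1 / c\<close> and \<open>1\<close>. For a single summand, with image \<open>P\<close>, the claim is
\<open>2 (x \<bullet> P y) \<le> c (x \<bullet> P x) + (y \<bullet> P y) / c\<close>.\<close>

lemma map_inverse_pairing:
  assumes Y: "hermitian_mat Y" "strictly_accretive Y"
  shows "2 * (x \<bullet> y) \<le> x \<bullet> (\<Phi> Y *v x) + y \<bullet> (\<Phi> (matrix_inv Y) *v y)"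
proof -
  obtain B where "finite B" "pairwise orthogonal B"
    and B: "\<And>b. b \<in> B \<Longrightarrow> norm b = 1" "\<And>b. b \<in> B \<Longrightarrow> Y *v b = (b \<bullet> (Y *v b)) *\<^sub>R b"
      "\<And>x. (\<Sum>b\<in>B. (b \<bullet> x) *\<^sub>R b) = x"
    by (rule selfadj_eigenbasis[OF hermitian_selfadj[OF Y(1)]]) (rule that)
  define c where "c b = b \<bullet> (Y *v b)" for b
  define P where "P b = \<Phi> (outer_square b)" for b
  have c: "0 < c b" if "b \<in> B" for b
    using Y(2) B(1)[OF that] unfolding c_def strictly_accretive_def by (metis norm_zero zero_neq_one)
  have Yb: "Y *v b = c b *\<^sub>R b" if "b \<in> B" for b using B(2)[OF that] by (simp add: c_def)
  have Yinv: "matrix_inv Y *v b = (1 / c b) *\<^sub>R b" if "b \<in> B" for b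
  proof -
    have "matrix_inv Y *v (Y *v b) = b" using Y by (simp add: mat_vec_inverse strictly_accretive_invertible)
    then have "c b *\<^sub>R (matrix_inv Y *v b) = b" by (simp add: Yb[OF that] mat_vec_simps)
    then have "(1 / c b) *\<^sub>R (c b *\<^sub>R (matrix_inv Y *v b)) = (1 / c b) *\<^sub>R b" by simp
    then show ?thesis using c[OF that] by simp
  qed
  have Phi2: "2 *\<^sub>R \<Phi> Z = (\<Sum>b\<in>B. g b *\<^sub>R P b)" if "\<And>b. b \<in> B \<Longrightarrow> Z *v b = g b *\<^sub>R b" for Z g
    using arg_cong[OF sum_outer_square_eigenbasis[where c = g, OF B(3) that], of \<Phi>]
    by (simp add: map_sum map_scaleR P_def)
  have form2: "2 * (x \<bullet> (\<Phi> Z *v y)) = (\<Sum>b\<in>B. g b * (x \<bullet> (P b *v y)))" 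
    if "\<And>b. b \<in> B \<Longrightarrow> Z *v b = g b *\<^sub>R b" for Z g x y
    using arg_cong[OF Phi2[OF that], of "\<lambda>Z. x \<bullet> (Z *v y)"]
    by (simp add: sum_mat_vec scaleR_mat_vec inner_sum_right)
  have "2 * (2 * (x \<bullet> y)) = (\<Sum>b\<in>B. 2 * (x \<bullet> (P b *v y)))"
    using form2[of "mat 1" "\<lambda>_. 1" x y] by (simp add: map_one sum_distrib_left)
  also have "\<dots> \<le> (\<Sum>b\<in>B. c b * (x \<bullet> (P b *v x)) + 1 / c b * (y \<bullet> (P b *v y)))"
  proof (rule sum_mono)
    fix b assume b: "b \<in> B"
    have P: "psd_op ((*v) (P b))" unfolding P_def by (intro psd_mat_psd_op map_psd psd_outer_square)
    have "0 \<le> (y + (- c b) *\<^sub>R x) \<bullet> (P b *v (y + (- c b) *\<^sub>R x))" using P by (simp add: psd_op_def)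
    also have "\<dots> = y \<bullet> (P b *v y) - 2 * c b * (y \<bullet> (P b *v x)) + (c b)\<^sup>2 * (x \<bullet> (P b *v x))"
      using P by (subst selfadj_form_add) (auto simp: psd_op_def)
    also have "y \<bullet> (P b *v x) = x \<bullet> (P b *v y)"
      using P by (auto simp: psd_op_def selfadj_def inner_commute)
    finally have "0 \<le> (y \<bullet> (P b *v y) - 2 * c b * (x \<bullet> (P b *v y)) + (c b)\<^sup>2 * (x \<bullet> (P b *v x))) / c b"
      using c[OF b] by simp
    then show "2 * (x \<bullet> (P b *v y)) \<le> c b * (x \<bullet> (P b *v x)) + 1 / c b * (y \<bullet> (P b *v y))"
      using c[OF b] by (simp add: add_divide_distrib diff_divide_distrib power2_eq_square)
  qed
  also have "\<dots> = 2 * (x \<bullet> (\<Phi> Y *v x)) + 2 * (y \<bullet> (\<Phi> (matrix_inv Y) *v y))"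
    using form2[OF Yb, of x x] form2[OF Yinv, of y y] by (simp add: sum.distrib)
  finally show ?thesis by simp
qed

text \<open>The inequality of Choi, obtained from the pairing at \<open>x = \<Phi>(Y)\<^sup>-\<^sup>1 y\<close>.\<close>

lemma map_inverse_le:
  assumes Y: "hermitian_mat Y" "strictly_accretive Y"
  shows "y \<bullet> (matrix_inv (\<Phi> Y) *v y) \<le> y \<bullet> (\<Phi> (matrix_inv Y) *v y)"
proof -
  define x where "x = matrix_inv (\<Phi> Y) *v y"
  have "\<Phi> Y *v x = y"
    using Y by (simp add: x_def mat_vec_inverse strictly_accretive_invertible map_positive_definite)
  then show ?thesis using map_inverse_pairing[OF Y, of x y] by (simp add: inner_commute flip: x_def)
qed

text \<open>The principle behind both parts: \<open>norm_product_le_quarter_square\<close> for \<open>P = \<Phi>(X)\<close> and \<open>Q = t \<Phi>(Y)\<^sup>-\<^sup>1\<close>, evaluated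
at the vector \<open>\<Phi>(Y) w\<close>.\<close>

lemma map_norm_le:
  assumes X: "psd_mat X" and Y: "hermitian_mat Y" "strictly_accretive Y" and t: "0 < t" and c: "0 < c"
    and le: "\<And>y. y \<bullet> (X *v y) + t * (y \<bullet> (matrix_inv Y *v y)) \<le> c * (y \<bullet> y)"
  shows "norm (\<Phi> X *v w) \<le> c\<^sup>2 / (4 * t) * norm (\<Phi> Y *v w)"
proof -
  have inv: "invertible Y" using Y(2) by (rule strictly_accretive_invertible)
  have "psd_mat Y" using Y by (simp add: psd_mat_def Re_cdot strictly_accretive_nonneg)
  then have hY: "hermitian_mat (\<Phi> Y)" using map_psd by (auto simp: psd_mat_def)
  have acc: "strictly_accretive (\<Phi> Y)" using Y by (rule map_positive_definite)
  define Q where "Q = t *\<^sub>R matrix_inv (\<Phi> Y)"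
  have hXY: "hermitian_mat (X + t *\<^sub>R matrix_inv Y)"
    using X hermitian_matrix_inv[OF Y(1) inv] by (simp add: hermitian_mat_def psd_mat_def)
  have "norm (\<Phi> X *v (Q *v (\<Phi> Y *v w))) \<le> c\<^sup>2 / 4 * norm (\<Phi> Y *v w)"
  proof (rule norm_product_le_quarter_square[where P = "(*v) (\<Phi> X)" and Q = "(*v) Q"])
    show "psd_op ((*v) (\<Phi> X))" by (intro psd_mat_psd_op map_psd X)
    have "hermitian_mat Q"
      using hermitian_matrix_inv[OF hY strictly_accretive_invertible[OF acc]] by (simp add: Q_def hermitian_mat_def)
    then show "psd_op ((*v) Q)"
      unfolding Q_def by (intro positive_definite_psd_op strictly_accretive_scaleR strictly_accretive_matrix_inv acc t)
    show "y \<bullet> (\<Phi> X *v y) + y \<bullet> (Q *v y) \<le> c * (y \<bullet> y)" for y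
    proof -
      have "y \<bullet> (\<Phi> (X + t *\<^sub>R matrix_inv Y) *v y) \<le> y \<bullet> (\<Phi> (c *\<^sub>R mat 1) *v y)"
        using le hXY by (intro map_form_mono) (auto simp: hermitian_mat_def mat_vec_simps inner_add)
      moreover have "t * (y \<bullet> (matrix_inv (\<Phi> Y) *v y)) \<le> t * (y \<bullet> (\<Phi> (matrix_inv Y) *v y))"
        using t map_inverse_le[OF Y] by (intro mult_left_mono) auto
      ultimately show ?thesis
        by (simp add: Q_def map_add map_scaleR map_one mat_vec_simps inner_add)
    qed
  qed (rule c)
  moreover have "Q *v (\<Phi> Y *v w) = t *\<^sub>R w"
    using acc by (simp add: Q_def mat_vec_simps mat_vec_inverse strictly_accretive_invertible)
  ultimately have "t * norm (\<Phi> X *v w) \<le> c\<^sup>2 / 4 * norm (\<Phi> Y *v w)"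
    using t by (simp add: mat_vec_simps)
  then show ?thesis using t by (simp add: field_simps)
qed

end

section \<open>The squared inequalities\<close>

text \<open>The form of the square of a Hermitian matrix at \<open>w\<close> is the squared norm of the image of \<open>w\<close>.\<close>

lemma sq_mat_loewner_le:
  fixes X Y :: "complex^'n^'n"
  assumes "hermitian_mat X" and "hermitian_mat Y" and "\<And>w. norm (X *v w) \<le> k * norm (Y *v w)"
    and "0 \<le> k" and "k\<^sup>2 \<le> l"
  shows "sq_mat X \<le>\<^sub>L l *\<^sub>R sq_mat Y"
proof -
  have h: "hermitian_mat (sq_mat Z)" if "hermitian_mat Z" for Z :: "complex^'n^'n"
    using that by (simp add: hermitian_mat_def sq_mat_def)
  have n: "w \<bullet> (sq_mat Z *v w) = (norm (Z *v w))\<^sup>2" if "hermitian_mat Z" for Z :: "complex^'n^'n" and w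
    using hermitian_selfadj[OF that]
    by (simp add: sq_mat_def selfadj_def power2_norm_eq_inner flip: matrix_vector_mul_assoc)
  have "(norm (X *v w))\<^sup>2 \<le> l * (norm (Y *v w))\<^sup>2" for w
  proof -
    have "(norm (X *v w))\<^sup>2 \<le> (k * norm (Y *v w))\<^sup>2" using assms(3) by (intro power_mono) auto
    also have "\<dots> = k\<^sup>2 * (norm (Y *v w))\<^sup>2" by (simp add: power_mult_distrib)
    also have "\<dots> \<le> l * (norm (Y *v w))\<^sup>2" using assms(5) by (intro mult_right_mono) auto
    finally show ?thesis .
  qed
  moreover have "hermitian_mat (l *\<^sub>R sq_mat Y)" using h[OF assms(2)] by (simp add: hermitian_mat_def)
  ultimately show ?thesis using assms h n by (simp add: loewner_le_iff mat_vec_simps)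
qed

lemma kantorovich_pointwise:
  fixes X :: "complex^'n^'n"
  assumes X: "strictly_accretive X" and m: "0 < m"
    and lo: "m *\<^sub>R mat 1 \<le>\<^sub>L re_mat X" and up: "re_mat X \<le>\<^sub>L M *\<^sub>R mat 1"
  shows "m * M * (y \<bullet> (matrix_inv (re_mat X) *v y)) + y \<bullet> (X *v y) \<le> (m + M) * (y \<bullet> y)"
proof -
  define p where "p = matrix_inv (re_mat X) *v y"
  have p: "re_mat X *v p = y"
    using X by (simp add: p_def mat_vec_inverse strictly_accretive_invertible strictly_accretive_re_mat)
  have "m * M * (p \<bullet> (re_mat X *v p)) + (re_mat X *v p) \<bullet> (re_mat X *v (re_mat X *v p)) 
      \<le> (m + M) * ((re_mat X *v p) \<bullet> (re_mat X *v p))"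
    using m loewner_leD[OF lo] loewner_leD[OF up]
    by (intro psd_op_between_inverse hermitian_selfadj hermitian_re_mat) (simp_all add: mat_vec_simps)
  then show ?thesis by (simp add: p re_mat_form) (simp add: p_def inner_commute)
qed

text \<open>The lower bound for the geometric mean at the test vector \<open>0\<close>.\<close>

lemma psd_re_geom_mean:
  assumes "sectorial t A" and "sectorial t B" and "0 \<le> t" and "0 \<le> v" "v \<le> 1"
  shows "psd_mat (re_mat (geom_mean v A B))"
proof -
  have "0 \<le> (1 + t\<^sup>2) * (y \<bullet> (geom_mean v A B *v y))" for y
    using geom_mean_form_ge[OF assms, of y 0] by simp
  moreover have "0 < 1 + t\<^sup>2" by (simp add: add_pos_nonneg)
  ultimately show ?thesis
    by (simp add: psd_mat_def hermitian_re_mat Re_cdot re_mat_form zero_le_mult_iff)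
qed

lemma kantorovich_scaled:
  assumes "0 < m" "m \<le> M"
  shows "(m + M)\<^sup>2 / (4 * (m * M)) = kantorovich (M / m)"
  using assms by (simp add: kantorovich_def field_simps power2_eq_square)

text \<open>Let \<open>G\<close> and \<open>H\<close> be the real parts of the geometric and the harmonic mean and \<open>X\<close> the weighted arithmetic mean of
\<open>A\<^sup>-\<^sup>1\<close> and \<open>B\<^sup>-\<^sup>1\<close>. Then \<open>H\<^sup>-\<^sup>1 \<le> (1 + t\<^sup>2) Re X\<close>, while \<open>geom_mean_form_le\<close> bounds \<open>m M G\<close> by the weighted mean of
\<open>m M (Re A\<^sup>-\<^sup>1)\<^sup>-\<^sup>1\<close> and \<open>m M (Re B\<^sup>-\<^sup>1)\<^sup>-\<^sup>1\<close>. Adding up, \<open>m M G + H\<^sup>-\<^sup>1 / (1 + t\<^sup>2) \<le> (m + M) I\<close>.\<close>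

lemma (in positive_unital_map) norm_geom_mean_le_harm_mean:
  assumes A: "sectorial t A" and B: "sectorial t B" and t: "0 \<le> t" and v: "0 \<le> v" "v \<le> 1" and m: "0 < m" "m \<le> M"
    and bA: "m *\<^sub>R mat 1 \<le>\<^sub>L re_mat (matrix_inv A)" "re_mat (matrix_inv A) \<le>\<^sub>L M *\<^sub>R mat 1"
    and bB: "m *\<^sub>R mat 1 \<le>\<^sub>L re_mat (matrix_inv B)" "re_mat (matrix_inv B) \<le>\<^sub>L M *\<^sub>R mat 1"
  shows "norm (\<Phi> (re_mat (geom_mean v A B)) *v w)
    \<le> (1 + t\<^sup>2) * kantorovich (M / m) * norm (\<Phi> (re_mat (harm_mean v A B)) *v w)"
proof -
  define C D where "C = matrix_inv A" and "D = matrix_inv B"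
  define G where "G = re_mat (geom_mean v A B)"
  define H where "H = re_mat (harm_mean v A B)"
  define X where "X = (1 - v) *\<^sub>R C + v *\<^sub>R D"
  have accAB: "strictly_accretive A" "strictly_accretive B" using A B by (auto simp: sectorial_def)
  then have acc: "strictly_accretive C" "strictly_accretive D"
    by (simp_all add: C_def D_def strictly_accretive_matrix_inv)
  have X: "sectorial t X" unfolding X_def C_def D_def using A B v by (intro sectorial_convex sectorial_matrix_inv)
  have invX: "invertible X" using X by (simp add: sectorial_def strictly_accretive_invertible)
  have H: "H = re_mat (matrix_inv X)" by (simp add: H_def harm_mean_def X_def C_def D_def)
  have t1: "0 < 1 + t\<^sup>2" by (simp add: add_pos_nonneg)
  have mM: "0 < m * M" using m by simp
  have "norm (\<Phi> G *v w) \<le> ((m + M) / (m * M))\<^sup>2 / (4 * (1 / ((1 + t\<^sup>2) * (m * M)))) * norm (\<Phi> H *v w)"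
  proof (rule map_norm_le)
    show "psd_mat G" unfolding G_def by (rule psd_re_geom_mean[OF A B t v])
    show "hermitian_mat H" "strictly_accretive H"
      unfolding H using sectorial_matrix_inv[OF X] 
      by (simp_all add: hermitian_re_mat strictly_accretive_re_mat sectorial_def)
    show "0 < 1 / ((1 + t\<^sup>2) * (m * M))" "0 < (m + M) / (m * M)" using mM t1 m by simp_all
    show "y \<bullet> (G *v y) + 1 / ((1 + t\<^sup>2) * (m * M)) * (y \<bullet> (matrix_inv H *v y)) \<le> (m + M) / (m * M) * (y \<bullet> y)" for y
    proof -
      have "y \<bullet> (matrix_inv H *v y) \<le> (1 + t\<^sup>2) * (y \<bullet> (X *v y))"
        using inverse_re_mat_le[OF sectorial_matrix_inv[OF X] t, of y] invX by (simp add: H matrix_inv_matrix_inv)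
      then have "y \<bullet> (matrix_inv H *v y) / (1 + t\<^sup>2) \<le> y \<bullet> (X *v y)"
        using t1 by (simp add: pos_divide_le_eq mult.commute)
      moreover have "m * M * (y \<bullet> (G *v y)) \<le> m * M * 
          ((1 - v) * (y \<bullet> (matrix_inv (re_mat C) *v y)) + v * (y \<bullet> (matrix_inv (re_mat D) *v y)))"
        using geom_mean_form_le[OF accAB v, of y] mM 
        by (intro mult_left_mono) (simp_all add: G_def re_mat_form C_def D_def)
      moreover have "(1 - v) * (m * M * (y \<bullet> (matrix_inv (re_mat C) *v y)) + y \<bullet> (C *v y))
          + v * (m * M * (y \<bullet> (matrix_inv (re_mat D) *v y)) + y \<bullet> (D *v y))
          \<le> (1 - v) * ((m + M) * (y \<bullet> y)) + v * ((m + M) * (y \<bullet> y))"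
        using v bA bB acc m unfolding C_def[symmetric] D_def[symmetric] 
        by (intro add_mono mult_left_mono kantorovich_pointwise) auto
      ultimately have "m * M * (y \<bullet> (G *v y)) + y \<bullet> (matrix_inv H *v y) / (1 + t\<^sup>2) \<le> (m + M) * (y \<bullet> y)"
        by (simp add: X_def mat_vec_simps inner_add algebra_simps)
      then have "(m * M * (y \<bullet> (G *v y)) + y \<bullet> (matrix_inv H *v y) / (1 + t\<^sup>2)) / (m * M) \<le> (m + M) * (y \<bullet> y) / (m * M)"
        using mM by (intro divide_right_mono) auto
      moreover have "(m * M * (y \<bullet> (G *v y)) + y \<bullet> (matrix_inv H *v y) / (1 + t\<^sup>2)) / (m * M)
          = y \<bullet> (G *v y) + 1 / ((1 + t\<^sup>2) * (m * M)) * (y \<bullet> (matrix_inv H *v y))"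
        using m by (simp add: add_divide_distrib)
      moreover have "(m + M) * (y \<bullet> y) / (m * M) = (m + M) / (m * M) * (y \<bullet> y)" by simp
      ultimately show ?thesis by (simp only:)
    qed
  qed
  also have "((m + M) / (m * M))\<^sup>2 / (4 * (1 / ((1 + t\<^sup>2) * (m * M)))) = (1 + t\<^sup>2) * ((m + M)\<^sup>2 / (4 * (m * M)))"
    using mM t1 by (simp add: power_divide power2_eq_square)
  finally show ?thesis using kantorovich_scaled[OF m] by (simp add: G_def H_def)
qed

text \<open>Let \<open>N\<close> and \<open>G\<close> be the real parts of the arithmetic and the geometric mean and \<open>K\<close> the weighted arithmetic mean of
\<open>(Re A)\<^sup>-\<^sup>1\<close> and \<open>(Re B)\<^sup>-\<^sup>1\<close>. The variational lower bound for \<open>G\<close> yields both that \<open>G\<close> is positive definite and that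
\<open>G\<^sup>-\<^sup>1 \<le> (1 + t\<^sup>2) K\<close>, hence \<open>N + m M G\<^sup>-\<^sup>1 / (1 + t\<^sup>2) \<le> (m + M) I\<close>.\<close>

lemma (in positive_unital_map) norm_arith_mean_le_geom_mean:
  assumes A: "sectorial t A" and B: "sectorial t B" and t: "0 \<le> t" and v: "0 \<le> v" "v \<le> 1" and m: "0 < m" "m \<le> M"
    and bA: "m *\<^sub>R mat 1 \<le>\<^sub>L re_mat A" "re_mat A \<le>\<^sub>L M *\<^sub>R mat 1"
    and bB: "m *\<^sub>R mat 1 \<le>\<^sub>L re_mat B" "re_mat B \<le>\<^sub>L M *\<^sub>R mat 1"
  shows "norm (\<Phi> (re_mat (arith_mean v A B)) *v w)
    \<le> (1 + t\<^sup>2) * kantorovich (M / m) * norm (\<Phi> (re_mat (geom_mean v A B)) *v w)"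
proof -
  define G where "G = re_mat (geom_mean v A B)"
  define N where "N = re_mat (arith_mean v A B)"
  have acc: "strictly_accretive A" "strictly_accretive B" using A B by (auto simp: sectorial_def)
  have t1: "0 < 1 + t\<^sup>2" by (simp add: add_pos_nonneg)
  have mM: "0 < m * M" using m by simp
  define K where "K = (1 - v) *\<^sub>R matrix_inv (re_mat A) + v *\<^sub>R matrix_inv (re_mat B)"
  have K: "strictly_accretive K"
    unfolding K_def using acc v
    by (intro strictly_accretive_convex strictly_accretive_matrix_inv) (simp_all add: strictly_accretive_re_mat)
  have ge: "2 * (y \<bullet> u) - u \<bullet> (K *v u) \<le> (1 + t\<^sup>2) * (y \<bullet> (G *v y))" for y u
    using geom_mean_form_ge[OF A B t v, of y u] by (simp add: G_def K_def re_mat_form mat_vec_simps inner_add)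
  have accG: "strictly_accretive G"
    unfolding strictly_accretive_def
  proof (intro allI impI)
    fix y :: "complex^'n" assume y: "y \<noteq> 0"
    then have k: "0 < y \<bullet> (K *v y)" using K by (simp add: strictly_accretive_def)
    \<comment> \<open>The multiple of \<open>y\<close> that maximizes the variational lower bound.\<close>
    define r where "r = (y \<bullet> y) / (y \<bullet> (K *v y))"
    have "0 < r * (y \<bullet> y)" using y k by (simp add: r_def)
    also have "\<dots> = 2 * (y \<bullet> (r *\<^sub>R y)) - (r *\<^sub>R y) \<bullet> (K *v (r *\<^sub>R y))"
      using k by (simp add: mat_vec_simps r_def)
    also have "\<dots> \<le> (1 + t\<^sup>2) * (y \<bullet> (G *v y))" by (rule ge)
    finally show "0 < y \<bullet> (G *v y)" using t1 by (simp add: zero_less_mult_iff)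
  qed
  have Ginv: "y \<bullet> (matrix_inv G *v y) \<le> (1 + t\<^sup>2) * (y \<bullet> (K *v y))" for y
  proof -
    define w g where "w = matrix_inv G *v y" and "g = 1 + t\<^sup>2"
    have w: "G *v w = y" using accG by (simp add: w_def mat_vec_inverse strictly_accretive_invertible)
    \<comment> \<open>The test vector \<open>r y\<close> bounds \<open>w \<bullet> y\<close> by \<open>r\<^sup>2 / (2 r - g)\<close> times \<open>y \<bullet> K y\<close>; the best choice is \<open>r = g\<close>.\<close>
    have "2 * g * (w \<bullet> y) - g\<^sup>2 * (y \<bullet> (K *v y)) \<le> g * (w \<bullet> y)"
      using ge[of w "g *\<^sub>R y", folded g_def] by (simp add: w mat_vec_simps power2_eq_square)
    then have "g * (w \<bullet> y) \<le> g * (g * (y \<bullet> (K *v y)))"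
      by (simp add: power2_eq_square mult_ac)
    then show ?thesis using t1 by (simp add: inner_commute flip: w_def g_def)
  qed
  have "norm (\<Phi> N *v w) \<le> (m + M)\<^sup>2 / (4 * (m * M / (1 + t\<^sup>2))) * norm (\<Phi> G *v w)"
  proof (rule map_norm_le)
    show "psd_mat N"
      using strictly_accretive_nonneg[OF strictly_accretive_convex[OF acc v]]
      by (simp add: N_def psd_mat_def Re_cdot hermitian_re_mat re_mat_form arith_mean_def)
    show "hermitian_mat G" unfolding G_def by (rule hermitian_re_mat)
    show "0 < m * M / (1 + t\<^sup>2)" "0 < m + M" using mM t1 m by simp_all
    show "y \<bullet> (N *v y) + m * M / (1 + t\<^sup>2) * (y \<bullet> (matrix_inv G *v y)) \<le> (m + M) * (y \<bullet> y)" for y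
    proof -
      have "m * M * (y \<bullet> (matrix_inv G *v y) / (1 + t\<^sup>2)) \<le> m * M * (y \<bullet> (K *v y))"
        using Ginv[of y] t1 mM by (intro mult_left_mono) (simp_all add: pos_divide_le_eq mult.commute)
      moreover have "(1 - v) * (m * M * (y \<bullet> (matrix_inv (re_mat A) *v y)) + y \<bullet> (A *v y))
          + v * (m * M * (y \<bullet> (matrix_inv (re_mat B) *v y)) + y \<bullet> (B *v y))
          \<le> (1 - v) * ((m + M) * (y \<bullet> y)) + v * ((m + M) * (y \<bullet> y))"
        using v bA bB acc m by (intro add_mono mult_left_mono kantorovich_pointwise) auto
      ultimately show ?thesis
        by (simp add: N_def re_mat_form arith_mean_def K_def mat_vec_simps inner_add algebra_simps)
    qed
  qed (rule accG)
  also have "(m + M)\<^sup>2 / (4 * (m * M / (1 + t\<^sup>2))) = (1 + t\<^sup>2) * ((m + M)\<^sup>2 / (4 * (m * M)))"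
    by simp
  finally show ?thesis using kantorovich_scaled[OF m] by (simp add: G_def N_def)
qed

theorem theorem2p1:
  fixes A B :: "complex ^ 'n ^ 'n"
    and \<Phi> :: "complex ^ 'n ^ 'n \<Rightarrow> complex ^ 'k ^ 'k"
    and \<alpha> v m M h :: real
  assumes "0 \<le> \<alpha>" and "\<alpha> < pi / 2"
    and "0 \<le> v" and "v \<le> 1"
    and "0 < m" and "m \<le> M"
    and "h = M / m"
    and "numerical_range A \<subseteq> sector \<alpha>" and "numerical_range B \<subseteq> sector \<alpha>"
    and "positive_unital_linear_map \<Phi>"
  shows "(m *\<^sub>R mat 1 \<le>\<^sub>L re_mat (matrix_inv A) \<and> re_mat (matrix_inv A) \<le>\<^sub>L M *\<^sub>R mat 1 \<and>
          m *\<^sub>R mat 1 \<le>\<^sub>L re_mat (matrix_inv B) \<and> re_mat (matrix_inv B) \<le>\<^sub>L M *\<^sub>R mat 1 \<longrightarrow>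
            sq_mat (\<Phi> (re_mat (geom_mean v A B)))
              \<le>\<^sub>L ((1 / cos \<alpha>) ^ 8 * (kantorovich h) ^ 2) *\<^sub>R sq_mat (\<Phi> (re_mat (harm_mean v A B)))) \<and>
         (m *\<^sub>R mat 1 \<le>\<^sub>L re_mat A \<and> re_mat A \<le>\<^sub>L M *\<^sub>R mat 1 \<and>
          m *\<^sub>R mat 1 \<le>\<^sub>L re_mat B \<and> re_mat B \<le>\<^sub>L M *\<^sub>R mat 1 \<longrightarrow>
            (inverse ((kantorovich h) ^ 2) * cos \<alpha> ^ 8) *\<^sub>R sq_mat (\<Phi> (re_mat (arith_mean v A B)))
              \<le>\<^sub>L sq_mat (\<Phi> (re_mat (geom_mean v A B))))"
proof -
  interpret positive_unital_map \<Phi> by standard (rule assms(10))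
  have cos: "0 < cos \<alpha>" using assms(1,2) by (intro cos_gt_zero_pi) auto
  define t where "t = tan \<alpha>"
  have "0 \<le> sin \<alpha>" using assms(1,2) by (intro sin_ge_zero) auto
  then have t: "0 \<le> t" using cos by (simp add: t_def tan_def)
  have sec: "1 + t\<^sup>2 = (1 / cos \<alpha>)\<^sup>2" using tan_sec[of \<alpha>] cos by (simp add: t_def inverse_eq_divide)
  note A = sectorial_numerical_range[OF assms(8), folded t_def]
    and B = sectorial_numerical_range[OF assms(9), folded t_def]
  note v = assms(3,4) and m = assms(5,6)
  have "0 < h" using m assms(7) by simp
  then have K: "0 < kantorovich h" unfolding kantorovich_def by (intro divide_pos_pos) auto
  define l where "l = (1 / cos \<alpha>) ^ 8 * (kantorovich h)\<^sup>2"
  have l: "0 < l" using cos K by (simp add: l_def)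
  define k where "k = (1 + t\<^sup>2) * kantorovich h"
  have k: "0 \<le> k" using K by (simp add: k_def)
  have "((1 / cos \<alpha>)\<^sup>2)\<^sup>2 \<le> (1 / cos \<alpha>) ^ 8"
    unfolding power_mult[symmetric] using cos by (intro power_increasing) auto
  then have kl: "k\<^sup>2 \<le> l" using sec by (simp add: k_def l_def power_mult_distrib mult_right_mono)
  have herm: "hermitian_mat (\<Phi> (re_mat X))" for X by (intro map_hermitian hermitian_re_mat)
  show ?thesis unfolding l_def[symmetric]
  proof (intro conjI impI; elim conjE)
    assume "m *\<^sub>R mat 1 \<le>\<^sub>L re_mat (matrix_inv A)" "re_mat (matrix_inv A) \<le>\<^sub>L M *\<^sub>R mat 1"
      "m *\<^sub>R mat 1 \<le>\<^sub>L re_mat (matrix_inv B)" "re_mat (matrix_inv B) \<le>\<^sub>L M *\<^sub>R mat 1"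
    from norm_geom_mean_le_harm_mean[OF A B t v m this, folded assms(7), folded k_def]
    show "sq_mat (\<Phi> (re_mat (geom_mean v A B))) \<le>\<^sub>L l *\<^sub>R sq_mat (\<Phi> (re_mat (harm_mean v A B)))"
      by (rule sq_mat_loewner_le[OF herm herm _ k kl])
  next
    assume "m *\<^sub>R mat 1 \<le>\<^sub>L re_mat A" "re_mat A \<le>\<^sub>L M *\<^sub>R mat 1"
      "m *\<^sub>R mat 1 \<le>\<^sub>L re_mat B" "re_mat B \<le>\<^sub>L M *\<^sub>R mat 1"
    from norm_arith_mean_le_geom_mean[OF A B t v m this, folded assms(7), folded k_def]
    have "sq_mat (\<Phi> (re_mat (arith_mean v A B))) \<le>\<^sub>L l *\<^sub>R sq_mat (\<Phi> (re_mat (geom_mean v A B)))"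
      by (rule sq_mat_loewner_le[OF herm herm _ k kl])
    moreover have "inverse ((kantorovich h)\<^sup>2) * cos \<alpha> ^ 8 = 1 / l"
      using cos K by (simp add: l_def field_simps)
    ultimately show "(inverse ((kantorovich h)\<^sup>2) * cos \<alpha> ^ 8) *\<^sub>R sq_mat (\<Phi> (re_mat (arith_mean v A B)))
        \<le>\<^sub>L sq_mat (\<Phi> (re_mat (geom_mean v A B)))"
      using loewner_le_scaleR_left l by simp
  qed
qed

end
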